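(* Suppose that Assumption A (stated in the context) holds. Let $(w,y,q)$ be obtained from $$\begin{bmatrix}\mathcal{L}_{zz}(z,\lambda)+E_{11}&\nabla g_{\mathcal{B}}(z)+E_{12}&\nabla g_{\mathcal{N}}(z)+E_{13}\\ \nabla g_{\mathcal{B}}(z)^T+E_{21}&-D_{\mathcal{B}}+E_{22}&E_{23}\\ \nabla g_{\mathcal{N}}(z)^T+E_{31}&E_{32}&-D_{\mathcal{N}}+E_{33}\end{bmatrix}\begin{bmatrix}w\\ y\\ q\end{bmatrix}=\begin{bmatrix}-\mathcal{L}_z(z,\lambda)+f_1\\ -g_{\mathcal{B}}(z)+\Lambda_{\mathcal{B}}^{-1}t_{\mathcal{B}}+f_2\\ -g_{\mathcal{N}}(z)+\Lambda_{\mathcal{N}}^{-1}t_{\mathcal{N}}+f_3\end{bmatrix},$$ where $D_{\mathcal{B}}=\Lambda_{\mathcal{B}}^{-1}S_{\mathcal{B}}$, $D_{\mathcal{N}}=\Lambda_{\mathcal{N}}^{-1}S_{\mathcal{N}}$, $$E_{11}=\delta_{\mathbf u}/\mu,\quad E_{33}=\delta_{\mathbf u}/\mu^2,\quad E_{12},E_{21},E_{22}=\delta_{\mathbf u},\quad E_{13},E_{31},E_{23},E_{32}=\delta_{\mathbf u}/\mu,$$ and $f_1,f_2,f_3$ are all of size $\delta_{\mathbf u}$. If $(\Delta z,\Delta\lambda,\Delta s)$ is the (exact) solution of $$\begin{bmatrix} \mathcal{L}_{zz}(z,\lambda) & \nabla g(z) & 0\\ \nabla g(z)^T & 0 & I\\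 0 & S & \Lambda\end{bmatrix}\begin{bmatrix}\Delta z\\ \Delta\lambda\\ \Delta s\end{bmatrix}=-\begin{bmatrix}\mathcal{L}_z(z,\lambda)\\ g(z)+s\\ S\Lambda e+t\end{bmatrix},$$ then $$(\Delta z-w,\;U^T(\Delta\lambda_{\mathcal{B}}-y))=\delta_{\mathbf u},\qquad V^T(\Delta\lambda_{\mathcal{B}}-y)=\delta_{\mathbf u}/\mu,\qquad \Delta\lambda_{\mathcal{N}}-q=\delta_{\mathbf u}.$$
   Context: (NLP) is $\min_z\phi(z)$ subject to $g(z)\le0$, where $\phi:\mathbb{R}^n\to\mathbb{R}$ and $g:\mathbb{R}^n\to\mathbb{R}^m$ are twice Lipschitz continuously differentiable. $\mathcal{L}(z,\lambda)=\phi(z)+\lambda^Tg(z)$; $\mathcal{L}_z$, $\mathcal{L}_{zz}$ are its gradient and Hessian in $z$. $\nabla g(z)=[\nabla g_1(z),\dots,\nabla g_m(z)]$. KKT conditions: $\mathcal{L}_z(z,\lambda)=0$, $g(z)\le0$, $\lambda\ge0$, $\lambda^Tg(z)=0$. $\mathcal{S}_\lambda$ is the set of $\lambda^*$ such that $(z^*,\lambda^* )$ satisfies the KKT conditions, $\mathcal{S}=\{z^*\}\times\mathcal{S}_\lambda$, $\delta(z,\lambda)$ is the Euclidean distance from $(z,\lambda)$ to $\mathcal{S}$. $\mathcal{B}=\{i:g_i(z^* )=0\}$, $\mathcal{N}=\{1,\dots,m\}\setminus\mathcal{B}$, $\mathcal{B}_+=\{i\in\mathcal{B}:\lambda_i^*>0\text{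 for some }\lambda^*\in\mathcal{S}_\lambda\}$. Subscripts $\mathcal{B},\mathcal{N}$ denote subvectors; $\nabla g_{\mathcal{B}}(z)$, $\nabla g_{\mathcal{N}}(z)$ have columns $\nabla g_i(z)$, $i\in\mathcal{B}$, resp. $i\in\mathcal{N}$. $S=\mathrm{diag}(s)$, $\Lambda=\mathrm{diag}(\lambda)$, with diagonal submatrices $S_{\mathcal{B}},\Lambda_{\mathcal{B}},S_{\mathcal{N}},\Lambda_{\mathcal{N}}$; $e=(1,\dots,1)^T$. SVD: $\nabla g_{\mathcal{B}}(z^* )=\begin{bmatrix}\hat U&\hat V\end{bmatrix}\begin{bmatrix}\Sigma&0\\ 0&0\end{bmatrix}\begin{bmatrix}U^T\\ V^T\end{bmatrix}=\hat U\Sigma U^T$ with $[\hat U\ \hat V]$, $[U\ V]$ orthogonal and $\Sigma$ diagonal with positive diagonal. $\sigma_{\min}$ denotes smallest eigenvalue. $\mathbf u\ge0$ is the unit roundoff, treated as a parameter. Assumption A. (a) $z^*$ is a solution of (NLP), so the KKT conditions hold ($\mathcal{S}_\lambda\neq\emptyset$). MFCQ: there is $\bar y$ with $\nabla g_{\mathcal{B}}(z^* )^T\bar y<0$. Second-order conditions: there is $\xi>0$ with $w^T\mathcal{L}_{zz}(z^*,\lambda^* )w\ge\xi\|w\|^2$ for all $\lambda^*\in\mathcal{S}_\lambda$ and all $w$ with $\nabla g_i(z^* )^Tw=0$ ($i\in\mathcal{B}_+$), $\nabla g_i(z^* )^Tw\le0$ ($i\in\mathcal{B}\setminus\mathcal{B}_+$).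 SC: some $\lambda^*\in\mathcal{S}_\lambda$ has $\lambda_i^*>0$ for all $i\in\mathcal{B}$. The current iterate $(z,\lambda,s)$ satisfies, with $\mu=\lambda^Ts/m$ and fixed constants $C>0$, $\gamma\in(0,1)$: $\|\mathcal{L}_z(z,\lambda)\|\le C\mu$, $\|g(z)+s\|\le C\mu$, $(\lambda,s)>0$, $\lambda_is_i\ge\gamma\mu$ for all $i$. The vector $t\in\mathbb{R}^m$ satisfies $t=O(\mu^2)$. (b) For a sufficiently large $\beta>0$: $\mathbf u/\mu\ll1$, $\mathbf u\ll1$, $\sigma_{\min}(\Sigma)\ge\beta\max(\mu^{1/3},\mathbf u/\mu)$, and $\sigma_{\min}(\hat V^T\mathcal{L}_{zz}(z^*,\lambda^* )\hat V)\ge\beta\max(\mu^{1/3},\mathbf u/\mu)$ for all $\lambda^*\in\mathcal{S}_\lambda$. Conventions: $O(\epsilon)$ means norm at most a constant times $\epsilon$; $\delta_{\mathbf u}$ denotes any quantity of norm at most a constant times $\mathbf u$. Precisely: for fixed problem, $z^*$, $C,\gamma$ and every choice of the constants implicit in the hypotheses, there exist $\epsilon,\eta,\beta_0,K'>0$ depending only on these such that, whenever the hypotheses hold with $\delta(z,\lambda)\le\epsilon$, $\mu\le\epsilon$, $\mathbf u/\mu\le\eta$, $\mathbf u\le\eta$, $\beta\ge\beta_0$, the conclusions hold with all implied constants equal to $K'$. *)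

theory Defs
  imports "Jordan_Normal_Form.Char_Poly" "HOL-Analysis.Analysis"
begin

(* Jordan_Normal_Form is used only for its matrices of arbitrary (possibly zero) dimension and
   their eigenvalues; everything else lives in real^'n and real^'m. *)
no_notation vec_index (infixl "$" 100)
hide_const (open) Matrix.mat Matrix.vec Matrix.row Matrix.col Determinant.det
  Matrix.diagonal_mat Matrix.scalar_prod
hide_type (open) Matrix.vec Matrix.mat

section \<open>Gradients, Hessians and the Lagrangian\<close>

definition grad :: "('a::real_inner \<Rightarrow> real) \<Rightarrow> 'a \<Rightarrow> 'a" where
  "grad f x = (THE D. GDERIV f x :> D)"

definition hess :: "(real^'n \<Rightarrow> real) \<Rightarrow> real^'n \<Rightarrow> real^'n^'n" where
  "hess f x = jacobian (grad f) (at x)"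

(* Local Lipschitz continuity of the Hessian; for a C^2 function this makes the function and its
   gradient locally Lipschitz as well. Global Lipschitz continuity is a special case. *)
definition twice_lipschitz_diff :: "(real^'n \<Rightarrow> real) \<Rightarrow> bool" where
  "twice_lipschitz_diff f \<longleftrightarrow>
     (\<forall>x. f differentiable (at x)) \<and>
     (\<forall>x. grad f differentiable (at x)) \<and>
     (\<forall>x. \<exists>r>0. \<exists>L. L-lipschitz_on (ball x r) (hess f))"

definition gradmat :: "(real^'n \<Rightarrow> real^'m) \<Rightarrow> real^'n \<Rightarrow> real^'m^'n" where
  "gradmat g x = (\<chi> i j. grad (\<lambda>x. g x $ j) x $ i)"

definition lagr :: "(real^'n \<Rightarrow> real) \<Rightarrow> (real^'n \<Rightarrow> real^'m) \<Rightarrow> real^'n \<Rightarrow> real^'m \<Rightarrow> real" where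
  "lagr \<phi> g z lam = \<phi> z + inner lam (g z)"

definition lagr_z :: "(real^'n \<Rightarrow> real) \<Rightarrow> (real^'n \<Rightarrow> real^'m) \<Rightarrow> real^'n \<Rightarrow> real^'m \<Rightarrow> real^'n" where
  "lagr_z \<phi> g z lam = grad (\<lambda>z. lagr \<phi> g z lam) z"

definition lagr_zz :: "(real^'n \<Rightarrow> real) \<Rightarrow> (real^'n \<Rightarrow> real^'m) \<Rightarrow> real^'n \<Rightarrow> real^'m \<Rightarrow> real^'n^'n" where
  "lagr_zz \<phi> g z lam = hess (\<lambda>z. lagr \<phi> g z lam) z"

section \<open>Solutions, multipliers and constraint qualifications\<close>

(* "Solution" is read as local minimizer, which includes global ones. *)
definition nlp_solution :: "(real^'n \<Rightarrow> real) \<Rightarrow> (real^'n \<Rightarrow> real^'m) \<Rightarrow> real^'n \<Rightarrow> bool" where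
  "nlp_solution \<phi> g zs \<longleftrightarrow> (\<forall>i. g zs $ i \<le> 0) \<and>
     (\<exists>r>0. \<forall>z\<in>ball zs r. (\<forall>i. g z $ i \<le> 0) \<longrightarrow> \<phi> zs \<le> \<phi> z)"

definition kkt :: "(real^'n \<Rightarrow> real) \<Rightarrow> (real^'n \<Rightarrow> real^'m) \<Rightarrow> real^'n \<Rightarrow> real^'m \<Rightarrow> bool" where
  "kkt \<phi> g z lam \<longleftrightarrow> lagr_z \<phi> g z lam = 0 \<and> (\<forall>i. g z $ i \<le> 0) \<and>
     (\<forall>i. 0 \<le> lam $ i) \<and> inner lam (g z) = 0"

definition multipliers :: "(real^'n \<Rightarrow> real) \<Rightarrow> (real^'n \<Rightarrow> real^'m) \<Rightarrow> real^'n \<Rightarrow> (real^'m) set" where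
  "multipliers \<phi> g zs = {lam. kkt \<phi> g zs lam}"

definition active :: "(real^'n \<Rightarrow> real^'m) \<Rightarrow> real^'n \<Rightarrow> 'm set" where
  "active g zs = {i. g zs $ i = 0}"

definition strongly_active :: "(real^'n \<Rightarrow> real) \<Rightarrow> (real^'n \<Rightarrow> real^'m) \<Rightarrow> real^'n \<Rightarrow> 'm set" where
  "strongly_active \<phi> g zs = {i\<in>active g zs. \<exists>lam\<in>multipliers \<phi> g zs. 0 < lam $ i}"

definition mfcq :: "(real^'n \<Rightarrow> real^'m) \<Rightarrow> real^'n \<Rightarrow> bool" where
  "mfcq g zs \<longleftrightarrow> (\<exists>y. \<forall>i\<in>active g zs. inner (grad (\<lambda>x. g x $ i) zs) y < 0)"

definition second_order_cond :: "(real^'n \<Rightarrow> real) \<Rightarrow> (real^'n \<Rightarrow> real^'m) \<Rightarrow> real^'n \<Rightarrow> bool" where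
  "second_order_cond \<phi> g zs \<longleftrightarrow>
     (\<exists>\<xi>>0. \<forall>lam\<in>multipliers \<phi> g zs. \<forall>w.
        (\<forall>i\<in>strongly_active \<phi> g zs. inner (grad (\<lambda>x. g x $ i) zs) w = 0) \<and>
        (\<forall>i\<in>active g zs - strongly_active \<phi> g zs. inner (grad (\<lambda>x. g x $ i) zs) w \<le> 0) \<longrightarrow>
        \<xi> * (norm w)\<^sup>2 \<le> inner w (lagr_zz \<phi> g zs lam *v w))"

definition strict_complementarity :: "(real^'n \<Rightarrow> real) \<Rightarrow> (real^'n \<Rightarrow> real^'m) \<Rightarrow> real^'n \<Rightarrow> bool" where
  "strict_complementarity \<phi> g zs \<longleftrightarrow>
     (\<exists>lam\<in>multipliers \<phi> g zs. \<forall>i\<in>active g zs. 0 < lam $ i)"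

section \<open>Subvectors and submatrices\<close>

(* For an index set I, a vector of R^I is represented by its extension by zero to the full index
   type, and likewise for matrices with rows in I and columns in J. Products, transposes,
   Euclidean and Frobenius norms are those of the unpadded objects. *)
definition subvec :: "'m set \<Rightarrow> real^'m \<Rightarrow> real^'m" where
  "subvec I v = (\<chi> i. if i \<in> I then v $ i else 0)"

definition submat :: "'k set \<Rightarrow> 'm set \<Rightarrow> real^'m^'k \<Rightarrow> real^'m^'k" where
  "submat I J A = (\<chi> i j. if i \<in> I \<and> j \<in> J then A $ i $ j else 0)"

definition diag :: "real^'m \<Rightarrow> real^'m^'m" where
  "diag v = (\<chi> i j. if i = j then v $ i else 0)"

section \<open>Singular value decomposition\<close>

(* The dimensions of the factors depend on the rank r, and some factors may be empty. A matrix
   with k columns is therefore a function on nat of which only the values at 0, ..., k-1 matter. *)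

definition orthonormal_cols :: "nat \<Rightarrow> (nat \<Rightarrow> 'a::real_inner) \<Rightarrow> bool" where
  "orthonormal_cols k Q \<longleftrightarrow> (\<forall>i<k. \<forall>j<k. inner (Q i) (Q j) = (if i = j then 1 else 0))"

definition append_cols :: "nat \<Rightarrow> (nat \<Rightarrow> 'a) \<Rightarrow> (nat \<Rightarrow> 'a) \<Rightarrow> nat \<Rightarrow> 'a" where
  "append_cols r P Q k = (if k < r then P k else Q (k - r))"

(* A = Uh diag(sg) U^T for a zero-padded matrix A with columns in B. [Uh Vh] is of size n x n and
   [U V] of size |B| x |B|, its columns being vectors of R^B; for these square matrices,
   orthonormal columns mean orthogonality. *)
definition svd :: "'m set \<Rightarrow> real^'m^'n \<Rightarrow> nat \<Rightarrow> (nat \<Rightarrow> real^'n) \<Rightarrow> (nat \<Rightarrow> real^'n) \<Rightarrow> (nat \<Rightarrow> real)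
    \<Rightarrow> (nat \<Rightarrow> real^'m) \<Rightarrow> (nat \<Rightarrow> real^'m) \<Rightarrow> bool" where
  "svd B A r Uh Vh sg U V \<longleftrightarrow>
     r \<le> CARD('n) \<and> r \<le> card B \<and>
     orthonormal_cols CARD('n) (append_cols r Uh Vh) \<and>
     orthonormal_cols (card B) (append_cols r U V) \<and>
     (\<forall>k<card B. subvec B (append_cols r U V k) = append_cols r U V k) \<and>
     (\<forall>k<r. 0 < sg k) \<and>
     (\<forall>i j. A $ i $ j = (\<Sum>k<r. Uh k $ i * sg k * U k $ j))"

definition diag_sg :: "nat \<Rightarrow> (nat \<Rightarrow> real) \<Rightarrow> real Matrix.mat" where
  "diag_sg r sg = Matrix.mat r r (\<lambda>(i, j). if i = j then sg i else 0)"

(* Q^T H Q, where Q has k columns *)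
definition compress :: "nat \<Rightarrow> (nat \<Rightarrow> real^'n) \<Rightarrow> real^'n^'n \<Rightarrow> real Matrix.mat" where
  "compress k Q H = Matrix.mat k k (\<lambda>(i, j). inner (Q i) (H *v Q j))"

(* Smallest eigenvalue; infinity for the 0 x 0 matrix, so that lower bounds on it are then void. *)
definition sigma_min :: "real Matrix.mat \<Rightarrow> ereal" where
  "sigma_min A = (INF x\<in>{x. eigenvalue A x}. ereal x)"

(* Euclidean norm of Q^T x for a matrix Q with k columns *)
definition norm_tmult :: "nat \<Rightarrow> (nat \<Rightarrow> 'a::real_inner) \<Rightarrow> 'a \<Rightarrow> real" where
  "norm_tmult k Q x = L2_set (\<lambda>i. inner (Q i) x) {..<k}"

section \<open>The interior-point step\<close>

definition mu :: "real^'m \<Rightarrow> real^'m \<Rightarrow> real" where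
  "mu lam s = inner lam s / CARD('m)"

definition iterate_ok :: "(real^'n \<Rightarrow> real) \<Rightarrow> (real^'n \<Rightarrow> real^'m) \<Rightarrow> real \<Rightarrow> real \<Rightarrow>
    real^'n \<Rightarrow> real^'m \<Rightarrow> real^'m \<Rightarrow> bool" where
  "iterate_ok \<phi> g C \<gamma> z lam s \<longleftrightarrow>
     norm (lagr_z \<phi> g z lam) \<le> C * mu lam s \<and> norm (g z + s) \<le> C * mu lam s \<and>
     (\<forall>i. 0 < lam $ i \<and> 0 < s $ i) \<and> (\<forall>i. \<gamma> * mu lam s \<le> lam $ i * s $ i)"

definition exact_step :: "(real^'n \<Rightarrow> real) \<Rightarrow> (real^'n \<Rightarrow> real^'m) \<Rightarrow>
    real^'n \<Rightarrow> real^'m \<Rightarrow> real^'m \<Rightarrow> real^'m \<Rightarrow> real^'n \<Rightarrow> real^'m \<Rightarrow> real^'m \<Rightarrow> bool" where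
  "exact_step \<phi> g z lam s t dz dlam ds \<longleftrightarrow>
     lagr_zz \<phi> g z lam *v dz + gradmat g z *v dlam = - lagr_z \<phi> g z lam \<and>
     transpose (gradmat g z) *v dz + ds = - (g z + s) \<and>
     diag s *v dlam + diag lam *v ds = - ((diag s ** diag lam) *v 1 + t)"

(* As diag lam is diagonal, (\<Lambda>_B)^{-1} is the B x B submatrix of \<Lambda>^{-1}. The perturbations E_ij,
   f_i and the unknowns y, q are required to be (zero-padded) objects of the block's shape. *)
definition perturbed_step :: "(real^'n \<Rightarrow> real) \<Rightarrow> (real^'n \<Rightarrow> real^'m) \<Rightarrow> 'm set \<Rightarrow>
    real^'n \<Rightarrow> real^'m \<Rightarrow> real^'m \<Rightarrow> real^'m \<Rightarrow>
    real^'n^'n \<Rightarrow> real^'m^'n \<Rightarrow> real^'m^'n \<Rightarrow>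
    real^'n^'m \<Rightarrow> real^'m^'m \<Rightarrow> real^'m^'m \<Rightarrow>
    real^'n^'m \<Rightarrow> real^'m^'m \<Rightarrow> real^'m^'m \<Rightarrow>
    real^'n \<Rightarrow> real^'m \<Rightarrow> real^'m \<Rightarrow>
    real^'n \<Rightarrow> real^'m \<Rightarrow> real^'m \<Rightarrow> bool" where
  "perturbed_step \<phi> g B z lam s t E11 E12 E13 E21 E22 E23 E31 E32 E33 f1 f2 f3 w y q \<longleftrightarrow>
     (let N = - B; G = gradmat g z; \<Lambda>' = matrix_inv (diag lam);
          D = (\<lambda>I. submat I I \<Lambda>' ** submat I I (diag s)) in
      submat UNIV B E12 = E12 \<and> submat UNIV N E13 = E13 \<and>
      submat B UNIV E21 = E21 \<and> submat B B E22 = E22 \<and> submat B N E23 = E23 \<and>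
      submat N UNIV E31 = E31 \<and> submat N B E32 = E32 \<and> submat N N E33 = E33 \<and>
      subvec B f2 = f2 \<and> subvec N f3 = f3 \<and> subvec B y = y \<and> subvec N q = q \<and>
      (lagr_zz \<phi> g z lam + E11) *v w + (submat UNIV B G + E12) *v y + (submat UNIV N G + E13) *v q
        = - lagr_z \<phi> g z lam + f1 \<and>
      (transpose (submat UNIV B G) + E21) *v w + (- D B + E22) *v y + E23 *v q
        = - subvec B (g z) + submat B B \<Lambda>' *v subvec B t + f2 \<and>
      (transpose (submat UNIV N G) + E31) *v w + E32 *v y + (- D N + E33) *v q
        = - subvec N (g z) + submat N N \<Lambda>' *v subvec N t + f3)"

end

theory Submission
  imports Defs
begin

text \<open>Since the constants may depend on the problem, strict complementarity and the second-order
  condition already make every \<open>L\<^sub>z\<^sub>z(z\<^sup>*, \<lambda>\<^sup>*)\<close> uniformly positive definite on the kernel of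
  \<open>A\<^sup>T\<close>, where \<open>A = \<nabla>g\<^sub>B(z\<^sup>*)\<close>, and the nonzero singular values of \<open>A\<close> are bounded away from zero.
  Near the solution set one has \<open>z - z\<^sup>* = O(\<mu>)\<close>, whence \<open>\<Lambda>\<^sup>-\<^sup>1 S\<close> is of exact order \<open>\<mu>\<close> on the active and
  at least of order \<open>1/\<mu>\<close> on the inactive constraints. For right-hand sides \<open>r\<^sub>1, r\<^sub>2, r\<^sub>3\<close> the reduced system
  then has a solution \<open>(a, b, c)\<close> in which \<open>a\<close>, \<open>U\<^sup>T b\<close>, \<open>\<mu> b\<close> and \<open>c\<close> are all
  \<open>O(\<rho>)\<close> with \<open>\<rho> = |r\<^sub>1| + |r\<^sub>2| + \<mu> |r\<^sub>3|\<close>. Applied to the exact step this gives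
  \<open>\<Delta>z, \<Delta>\<lambda>\<^sub>N = O(\<mu>)\<close> and \<open>\<Delta>\<lambda>\<^sub>B = O(1)\<close>. The difference of the two steps solves the same system with
  right-hand sides made of the perturbations applied to the perturbed step, for which
  \<open>\<rho> = O(u) + O(u/\<mu>) \<rho>\<close>, so that \<open>\<rho> = O(u)\<close> once \<open>u/\<mu>\<close> is small.\<close>

section \<open>Matrices and subvectors\<close>

text \<open>The columns of \<open>A\<close> may be linearly dependent, so multipliers need not be
  unique and the limiting saddle matrix without \<open>D_B\<close> is singular along ker A. There
  only \<open>D_B\<close>, of order \<mu>, acts; this is the source of the factor 1/\<mu> in the
  V-part. The third row carries the weight \<mu> in \<rho> because \<open>D_N\<close> is at least of
  order 1/\<mu>: solving that row for c gains a factor \<mu>. The sizes of the perturbations match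
  these weights and the sizes of the exact step: \<open>E33\<close> of size u/\<mu>^2 meets a vector
  of order \<mu> in a row weighted by \<mu>, \<open>E11\<close> of size u/\<mu> a vector of order
  \<mu>, \<open>E12\<close> of size u a vector of order 1, and each product is O(u). Neither a bound
  on the computed step nor invertibility of the perturbed matrix is available beforehand, so the
  computed step is bounded by the exact one plus the unknown error, and this is what makes \<rho>
  reappear on the right.\<close>

no_notation Matrix.scalar_prod (infix "\<bullet>" 70)

text \<open>The norm on \<open>real^'m^'n\<close> is the Euclidean norm of the row norms, hence the
  Frobenius norm, and Cauchy-Schwarz applies to each row.\<close>

lemma norm_matrix_vector_le:
  fixes A :: "real^'m^'n"
  shows "norm (A *v x) \<le> norm A * norm x"
proof -
  have "norm (A *v x) \<le> L2_set (\<lambda>i. norm (A $ i) * norm x) UNIV"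
    unfolding norm_vec_def [of "A *v x"]
    by (rule L2_set_mono) (auto simp: matrix_vector_mul_component Cauchy_Schwarz_ineq2)
  also have "\<dots> = norm A * norm x"
    by (simp add: norm_vec_def [of A] L2_set_right_distrib mult.commute)
  finally show ?thesis .
qed

lemma norm_matrix_vector_mono:
  fixes A :: "real^'m^'n"
  assumes "norm A \<le> K"
  shows "norm (A *v x) \<le> K * norm x"
  using norm_matrix_vector_le [of A x] mult_right_mono [OF assms norm_ge_zero, of x] by linarith

lemma norm_matrix_eq:
  fixes A :: "real^'m^'n"
  shows "norm A = sqrt (\<Sum>i\<in>UNIV. \<Sum>j\<in>UNIV. (A $ i $ j)\<^sup>2)"
  by (simp add: norm_vec_def L2_set_def sum_nonneg)

lemma norm_transpose:
  fixes A :: "real^'m^'n"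
  shows "norm (transpose A) = norm A"
  unfolding norm_matrix_eq by (simp add: transpose_def) (rule sum.swap)

lemma transpose_diff: "transpose (A - B) = transpose A - transpose (B :: real^'m^'n)"
  by (simp add: transpose_def vec_eq_iff)

lemma inner_transpose_mult:
  fixes A :: "real^'m^'n"
  shows "x \<bullet> (transpose A *v y) = (A *v x) \<bullet> y"
  by (metis dot_lmul_matrix inner_commute transpose_matrix_vector)

lemma norm_subvec_le: "norm (subvec I v) \<le> norm v"
  unfolding norm_vec_def by (rule L2_set_mono) (auto simp: subvec_def)

lemma norm_submat_le:
  fixes A :: "real^'m^'n"
  shows "norm (submat I J A) \<le> norm A"
  unfolding norm_matrix_eq by (auto intro!: sum_mono simp: submat_def)

text \<open>Constraint gradients are the columns of \<open>gradmat\<close>, whereas the norm is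
  built from rows; this transfers columnwise Lipschitz bounds to the matrix.\<close>

lemma norm_matrix_le_sum_columns:
  fixes A :: "real^'m^'n"
  shows "norm A \<le> (\<Sum>j\<in>UNIV. norm (\<chi> i. A $ i $ j))"
proof -
  have "norm (transpose A) \<le> (\<Sum>j\<in>UNIV. norm (transpose A $ j))"
    unfolding norm_vec_def [of "transpose A"] by (rule L2_set_le_sum) auto
  then show ?thesis by (simp add: norm_transpose) (simp add: transpose_def)
qed

lemma submat_diff: "submat I J (A - B) = submat I J A - submat I J B"
  by (simp add: submat_def vec_eq_iff)

lemma submat_mult_vec:
  fixes A :: "real^'m^'n"
  shows "submat UNIV J A *v x = A *v subvec J x"
  by (simp add: vec_eq_iff matrix_vector_mult_def submat_def subvec_def if_distrib if_distribR
      cong: if_cong)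

lemma transpose_submat_mult_vec:
  fixes A :: "real^'m^'n"
  shows "transpose (submat UNIV J A) *v x = subvec J (transpose A *v x)"
  by (simp add: vec_eq_iff matrix_vector_mult_def transpose_def submat_def subvec_def)

lemma subvec_add_compl: "subvec I v + subvec (- I) v = v"
  by (simp add: subvec_def vec_eq_iff)

text \<open>A linear right inverse h of A on its range gives the kernel vector x - h(Ax), and
  boundedness of h gives the constant. It replaces the reciprocal of the smallest nonzero singular
  value.\<close>

lemma matrix_dist_kernel_le:
  fixes A :: "real^'m^'n"
  shows "\<exists>\<kappa>>0. \<forall>x. \<exists>v. A *v v = 0 \<and> norm (x - v) \<le> \<kappa> * norm (A *v x)"
proof -
  obtain h where h: "linear h" "\<And>v. A *v h (A *v v) = A *v v"
    using linear_exists_right_inverse_on [of "(*v) A" UNIV] matrix_vector_mul_linear [of A] by auto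
  obtain \<kappa> where \<kappa>: "0 < \<kappa>" "\<And>y. norm (h y) \<le> \<kappa> * norm y"
    using linear_bounded_pos [OF h(1)] by auto
  have "A *v (x - h (A *v x)) = 0 \<and> norm (x - (x - h (A *v x))) \<le> \<kappa> * norm (A *v x)" for x
    by (simp add: matrix_vector_mult_diff_distrib h(2) \<kappa>(2))
  then show ?thesis using \<kappa>(1) by blast
qed

section \<open>Saddle point systems\<close>

text \<open>Here a, b, c stand for the norms of the unknowns, a' and w for the two parts of a, and
  \<beta> and \<nu> for the parts of b off and in ker A. The part \<nu> returns into the other
  bounds only through \<mu> * b, which is controlled by \<mu> times a and \<beta>, plus R2, up to
  the factor P; so the circular system can be absorbed for small \<mu>.\<close>

lemma saddle_scalar_bound:
  fixes P \<mu> a a' w b \<nu> \<beta> c R1 R2 R3 \<rho> :: real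
  assumes P: "1 \<le> P" and \<mu>: "0 \<le> \<mu>" "48 * P^4 * \<mu> \<le> 1"
    and nonneg: "0 \<le> a" "0 \<le> a'" "0 \<le> w" "0 \<le> b" "0 \<le> \<nu>" "0 \<le> \<beta>" "0 \<le> c" "0 \<le> R1" "0 \<le> R2" "0 \<le> R3"
    and c: "c \<le> P * (\<mu> * (a + R3))"
    and \<nu>: "\<mu> * \<nu> \<le> P * (\<mu> * a + \<mu> * \<beta> + R2)"
    and b: "b \<le> \<beta> + \<nu>"
    and \<beta>: "\<beta> \<le> P * (R1 + a + c + \<mu> * b)"
    and a': "a' \<le> P * (R2 + \<mu> * b + \<mu> * a)"
    and w: "w \<le> P * (R1 + \<mu> * b + c + a')"
    and a: "a \<le> a' + w"
    and \<rho>: "\<rho> = R1 + R2 + \<mu> * R3"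
  shows "a \<le> 48 * P^4 * \<rho>" "\<beta> \<le> 48 * P^4 * \<rho>" "\<mu> * b \<le> 48 * P^4 * \<rho>" "c \<le> 48 * P^4 * \<rho>"
proof -
  \<comment> \<open>\<open>T\<close> contains the unknowns only with the weight \<mu>; each bound
    below is a numeric multiple of some P^k * T.\<close>
  define T where "T = \<mu> * (a + \<beta>) + \<rho>"
  have nn: "0 \<le> \<mu> * a" "0 \<le> \<mu> * \<beta>" "0 \<le> \<mu> * R3"
    using \<mu> nonneg by auto
  have T: "T = \<mu> * a + \<mu> * \<beta> + R1 + R2 + \<mu> * R3"
    by (simp add: T_def \<rho> algebra_simps)
  have T0: "0 \<le> T" and \<rho>0: "0 \<le> \<rho>" using T \<rho> nn nonneg by auto
  have PT: "T \<le> P * T" "P * T \<le> P^2 * T" "P^2 * T \<le> P^3 * T" "P^3 * T \<le> P^4 * T"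
    using mult_right_mono [OF P, of "T"] mult_right_mono [OF P, of "P*T"]
      mult_right_mono [OF P, of "P^2*T"] mult_right_mono [OF P, of "P^3*T"] T0 P
    by (simp_all add: power_numeral_reduce mult.assoc)
  have Pm: "x \<le> y \<Longrightarrow> P * x \<le> P * y" for x y
    using P by (simp add: mult_left_mono)
  have "\<mu> * a + \<mu> * \<beta> + R2 \<le> T" using T nn nonneg by linarith
  then have \<nu>T: "\<mu> * \<nu> \<le> P * T" using \<nu> Pm by fastforce
  have "\<mu> * b \<le> \<mu> * \<beta> + \<mu> * \<nu>"
    using mult_left_mono [OF b \<mu>(1)] by (simp add: algebra_simps)
  then have bT: "\<mu> * b \<le> 2 * (P * T)" using \<nu>T T nn nonneg PT(1) by linarith
  have "\<mu> * (a + R3) \<le> T" using T nn nonneg by (simp add: algebra_simps)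
  then have cT: "c \<le> P * T" using c Pm by fastforce
  have "R2 + \<mu> * b + \<mu> * a \<le> 3 * (P * T)"
    using bT PT T nn nonneg by linarith
  then have a'T: "a' \<le> 3 * (P^2 * T)"
    using a' Pm [of "R2 + \<mu> * b + \<mu> * a" "3 * (P * T)"] by (simp add: power_numeral_reduce)
  have "R1 + \<mu> * b + c + a' \<le> 7 * (P^2 * T)"
    using bT cT a'T PT T nn nonneg by linarith
  then have wT: "w \<le> 7 * (P^3 * T)"
    using w Pm [of "R1 + \<mu> * b + c + a'" "7 * (P^2 * T)"] by (simp add: power_numeral_reduce)
  have aT: "a \<le> 10 * (P^3 * T)" using a a'T wT PT by linarith
  have "R1 + a + c + \<mu> * b \<le> 14 * (P^3 * T)"
    using aT cT bT PT T nn nonneg by linarith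
  then have \<beta>T: "\<beta> \<le> 14 * (P^4 * T)"
    using \<beta> Pm [of "R1 + a + c + \<mu> * b" "14 * (P^3 * T)"] by (simp add: power_numeral_reduce)
  \<comment> \<open>24 = 10 + 14. The part of 24 * P^4 * T that contains the unknowns is at most
    half of a + \<beta>, since 48 * P^4 * \<mu> is at most 1; moving it to the left doubles 24 to
    48.\<close>
  have ab: "a + \<beta> \<le> 24 * (P^4 * T)" using aT \<beta>T PT by linarith
  have "48 * (P^4 * (\<mu> * (a + \<beta>))) \<le> a + \<beta>"
    using mult_right_mono [OF \<mu>(2), of "a + \<beta>"] nonneg by (simp add: mult.assoc)
  then have ab': "a + \<beta> \<le> 48 * (P^4 * \<rho>)"
    using ab by (simp add: T_def algebra_simps)
  \<comment> \<open>The bound is fed back into \<open>T\<close>, which then controls \<mu> * b and c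
    as well.\<close>
  have "\<mu> * (a + \<beta>) \<le> \<mu> * (48 * (P^4 * \<rho>))" using ab' \<mu>(1) by (rule mult_left_mono)
  also have "\<dots> = (48 * P^4 * \<mu>) * \<rho>" by (simp add: ac_simps)
  also have "\<dots> \<le> \<rho>" using mult_right_mono [OF \<mu>(2) \<rho>0] by simp
  finally have T2: "T \<le> 2 * \<rho>" by (simp add: T_def)
  have P4: "P^4 * T \<le> P^4 * (2 * \<rho>)" using T2 P by (intro mult_left_mono) auto
  have P4': "0 \<le> P^4 * \<rho>" using P \<rho>0 by simp
  show "a \<le> 48 * P^4 * \<rho>" "\<beta> \<le> 48 * P^4 * \<rho>"
    unfolding mult.assoc using ab' nonneg P4' by linarith+
  have "4 * (P^4 * \<rho>) \<le> 48 * (P^4 * \<rho>)" using P4' by linarith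
  moreover have "2 * (P * T) \<le> 4 * (P^4 * \<rho>)"
    using P4 PT by linarith
  ultimately show "\<mu> * b \<le> 48 * P^4 * \<rho>" "c \<le> 48 * P^4 * \<rho>"
    unfolding mult.assoc using bT cT T0 P4 PT by linarith+
qed

lemma le_of_square_le_mult:
  fixes x c :: real
  assumes "x\<^sup>2 \<le> c * x" "0 \<le> x" "0 \<le> c"
  shows "x \<le> c"
  using assms by (cases "x = 0") (auto simp: power2_eq_square)

lemma abs_inner_le_mult:
  fixes x y :: "'a::real_inner"
  assumes "norm y \<le> K"
  shows "\<bar>x \<bullet> y\<bar> \<le> norm x * K"
  using Cauchy_Schwarz_ineq2 [of x y] mult_left_mono [OF assms norm_ge_zero, of x] by linarith

lemma norm_vec_le_scaled:
  fixes x y :: "real^'m"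
  assumes "\<And>i. \<bar>x $ i\<bar> \<le> K * \<bar>y $ i\<bar>" and "0 \<le> K"
  shows "norm x \<le> K * norm y"
proof -
  have "norm x \<le> norm (K *\<^sub>R y)"
    unfolding norm_vec_def by (rule L2_set_mono) (use assms in \<open>auto simp: abs_mult\<close>)
  then show ?thesis using assms by simp
qed

lemma norm_diff4_le:
  fixes p :: "'a::real_normed_vector"
  shows "norm (p - q - r - s) \<le> norm p + norm q + norm r + norm s"
  using norm_triangle_ineq4 [of "p - q - r" s] norm_triangle_ineq4 [of "p - q" r]
    norm_triangle_ineq4 [of p q] by linarith

lemma norm_add_diff_le:
  fixes p :: "'a::real_normed_vector"
  shows "norm (p + q - r) \<le> norm p + norm q + norm r"
  using norm_triangle_ineq4 [of "p + q" r] norm_triangle_ineq [of p q] by linarith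

text \<open>The multiplier error \<open>b\<close> is split as \<open>b' + v\<close> with \<open>v\<close> in the kernel of \<open>A\<close>, and \<open>a\<close> as \<open>a' + w\<close> with
  \<open>w\<close> in the kernel of \<open>A\<^sup>T\<close>. Only \<open>v\<close> is divided by the small block \<open>D\<^sub>B \<approx> \<mu>\<close>; since \<open>A' v = O(\<mu>)\<close>, this
  does not feed back into the other components.\<close>

lemma saddle_estimate:
  fixes A A' G :: "real^'m^'n" and H :: "real^'n^'n" and D :: "real^'m"
  assumes M: "1 \<le> M" and mu: "0 < \<mu>" "48 * (M^2)^4 * \<mu> \<le> 1"
    and ker: "\<And>x. \<exists>v. A *v v = 0 \<and> norm (x - v) \<le> M * norm (A *v x)"
    and kerT: "\<And>x. \<exists>v. transpose A *v v = 0 \<and> norm (x - v) \<le> M * norm (transpose A *v x)"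
    and supp: "\<And>x. A *v subvec B x = A *v x"
    and pos: "\<And>w. transpose A *v w = 0 \<Longrightarrow> (norm w)\<^sup>2 \<le> M * (w \<bullet> (H *v w))"
    and near: "norm (A' - A) \<le> M * \<mu>" and H: "norm H \<le> M" and G: "norm G \<le> M"
    and DB: "\<And>i. i \<in> B \<Longrightarrow> \<mu> \<le> M * D $ i \<and> D $ i \<le> M * \<mu>"
    and DN: "\<And>i. i \<notin> B \<Longrightarrow> 1 \<le> M * \<mu> * D $ i"
    and b: "subvec B b = b" and c: "subvec (- B) c = c"
    and eq1: "H *v a + A' *v b + G *v c = r1"
    and eq2: "transpose A' *v a - (\<chi> i. D $ i * b $ i) = r2"
    and eq3: "transpose G *v a - (\<chi> i. D $ i * c $ i) = r3"
    and \<rho>: "\<rho> = norm r1 + norm r2 + \<mu> * norm r3"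
    and K: "K = 48 * (M^2)^4"
  shows "norm a \<le> K * \<rho> \<and> \<mu> * norm b \<le> K * \<rho> \<and> norm c \<le> K * \<rho> \<and>
    (\<exists>v. A *v v = 0 \<and> norm (b - v) \<le> K * \<rho>)"
proof -
  define Db where "Db x = (\<chi> i. D $ i * (x :: real^'m) $ i)" for x
  have Mm: "x \<le> y \<Longrightarrow> M * x \<le> M * y" for x y
    using M by (simp add: mult_left_mono)
  have M2: "M * (M * x) = M^2 * x" for x
    by (simp add: power2_eq_square)
  obtain v0 where v0: "A *v v0 = 0" "norm (b - v0) \<le> M * norm (A *v b)"
    using ker by blast
  \<comment> \<open>\<open>A\<close> ignores the entries off \<open>B\<close>, so cutting v0 down to
    \<open>B\<close> keeps it in the kernel; the bounds \<open>DB\<close> then apply to both parts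
    of b.\<close>
  define v where "v = subvec B v0"
  define b' where "b' = b - v"
  have bB: "i \<notin> B \<Longrightarrow> b $ i = 0" for i
    by (subst b [symmetric]) (simp add: subvec_def)
  have b'_eq: "b' = subvec B (b - v0)"
    using bB by (auto simp: b'_def v_def subvec_def vec_eq_iff)
  have v: "A *v v = 0" "norm b' \<le> M * norm (A *v b)"
    using supp [of v0] v0 norm_subvec_le [of B "b - v0"] by (simp_all add: v_def b'_eq)
  have vB: "i \<notin> B \<Longrightarrow> v $ i = 0" and b'B: "i \<notin> B \<Longrightarrow> b' $ i = 0" for i
    by (simp_all add: v_def b'_eq subvec_def)
  obtain w where w: "transpose A *v w = 0" "norm (a - w) \<le> M * norm (transpose A *v a)"
    using kerT by blast
  define a' where "a' = a - w"
  have nearT: "norm (transpose (A' - A)) \<le> M * \<mu>"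
    using near by (simp add: norm_transpose)
  have near': "norm ((A' - A) *v x) \<le> M * (\<mu> * norm x)"
     "norm (transpose (A' - A) *v y) \<le> M * (\<mu> * norm y)" for x y
    using norm_matrix_vector_mono [OF near, of x] norm_matrix_vector_mono [OF nearT, of y]
    by (simp_all add: mult.assoc)
  have DbB: "norm (Db x) \<le> M * (\<mu> * norm x)" if "\<And>i. i \<notin> B \<Longrightarrow> x $ i = 0" for x
  proof -
    have "\<bar>Db x $ i\<bar> \<le> (M * \<mu>) * \<bar>x $ i\<bar>" for i
    proof (cases "i \<in> B")
      case True
      then have "\<bar>D $ i\<bar> \<le> M * \<mu>" using DB [OF True] M mu by (smt (verit) zero_less_mult_pos)
      then show ?thesis by (simp add: Db_def abs_mult mult_right_mono)
    qed (simp add: Db_def that)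
    then show ?thesis
      using norm_vec_le_scaled [of "Db x" "M * \<mu>" x] M mu by (simp add: mult.assoc)
  qed
  \<comment> \<open>The third row is solved for c; off \<open>B\<close>, division by
    \<open>D\<close> gains the factor M * \<mu>.\<close>
  have c1: "norm c \<le> M\<^sup>2 * (\<mu> * (norm a + norm r3))"
  proof -
    have "\<bar>c $ i\<bar> \<le> (M * \<mu>) * \<bar>Db c $ i\<bar>" for i
    proof (cases "i \<in> B")
      case True
      then have "c $ i = 0" by (subst c [symmetric]) (simp add: subvec_def)
      then show ?thesis using M mu by simp
    next
      case False
      have "0 \<le> D $ i" using DN [OF False] M mu by (smt (verit) zero_less_mult_pos mult_pos_pos)
      then show ?thesis
        using mult_right_mono [OF DN [OF False], of "\<bar>c $ i\<bar>"]
        by (simp add: Db_def abs_mult mult.assoc)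
    qed
    then have "norm c \<le> (M * \<mu>) * norm (Db c)"
      using M mu by (intro norm_vec_le_scaled) auto
    also have "Db c = transpose G *v a - r3"
      using eq3 by (simp add: Db_def algebra_simps)
    also have "norm \<dots> \<le> M * norm a + norm r3"
      using norm_triangle_ineq4 [of "transpose G *v a" r3] norm_matrix_vector_mono [of "transpose G" M a] G
      by (simp add: norm_transpose)
    also have "\<dots> \<le> M * (norm a + norm r3)"
      using mult_right_mono [OF M norm_ge_zero, of r3] by (simp add: distrib_left)
    finally show ?thesis using M mu by (simp add: power2_eq_square ac_simps)
  qed
  \<comment> \<open>The second row is tested with v: the form v . D v is at least \<mu> * |v|^2 / M,
    and A v = 0 cancels the term with A^T a, leaving only A' - A, which is of order \<mu>.\<close>
  have \<nu>: "\<mu> * norm v \<le> M\<^sup>2 * (\<mu> * norm a + \<mu> * norm b' + norm r2)"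
  proof -
    have "\<mu> * (norm v)\<^sup>2 = (\<Sum>i\<in>UNIV. \<mu> * (v $ i)\<^sup>2)"
      unfolding power2_norm_eq_inner inner_vec_def by (simp add: sum_distrib_left power2_eq_square)
    also have "\<dots> \<le> (\<Sum>i\<in>UNIV. M * (v $ i * Db v $ i))"
    proof (rule sum_mono)
      fix i show "\<mu> * (v $ i)\<^sup>2 \<le> M * (v $ i * Db v $ i)"
        using DB [of i] mult_right_mono [of \<mu> "M * D $ i" "(v $ i)\<^sup>2"] vB [of i]
        by (cases "i \<in> B") (auto simp: Db_def power2_eq_square ac_simps)
    qed
    also have "\<dots> = M * (v \<bullet> Db v)"
      by (simp add: inner_vec_def sum_distrib_left)
    also have "Db v = transpose A' *v a - r2 - Db b'"
      using eq2 by (simp add: Db_def b'_def vec_eq_iff algebra_simps)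
    also have "transpose A' *v a = transpose (A' - A) *v a + transpose A *v a"
      by (simp add: transpose_diff matrix_vector_mult_diff_rdistrib)
    also have "v \<bullet> (transpose (A' - A) *v a + transpose A *v a - r2 - Db b')
       = v \<bullet> (transpose (A' - A) *v a - r2 - Db b')"
      using inner_transpose_mult [of v A a] v by (simp add: inner_diff_right inner_add_right)
    also have "M * \<dots> \<le> M * (norm v * (M * (\<mu> * norm a) + norm r2 + M * (\<mu> * norm b')))"
    proof (rule Mm)
      have "norm (transpose (A' - A) *v a - r2 - Db b') \<le> M * (\<mu> * norm a) + norm r2 + M * (\<mu> * norm b')"
        using norm_triangle_ineq4 [of "transpose (A' - A) *v a - r2" "Db b'"]
          norm_triangle_ineq4 [of "transpose (A' - A) *v a" "r2"] near'(2) [of a] DbB [of b'] b'B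
        by fastforce
      from abs_inner_le_mult [OF this, of v]
      show "v \<bullet> (transpose (A' - A) *v a - r2 - Db b') \<le> norm v * (M * (\<mu> * norm a) + norm r2 + M * (\<mu> * norm b'))"
        by linarith
    qed
    finally have "(\<mu> * norm v)\<^sup>2 \<le> (M * (M * (\<mu> * norm a) + norm r2 + M * (\<mu> * norm b'))) * (\<mu> * norm v)"
      using mu mult_left_mono [of "\<mu> * (norm v)\<^sup>2" _ \<mu>] by (simp add: power2_eq_square ac_simps)
    then have "\<mu> * norm v \<le> M * (M * (\<mu> * norm a) + norm r2 + M * (\<mu> * norm b'))"
      by (rule le_of_square_le_mult) (use M mu in auto)
    also have "\<dots> \<le> M * (M * (\<mu> * norm a + \<mu> * norm b' + norm r2))"
      using mult_right_mono [OF M norm_ge_zero, of r2] by (intro Mm) (simp add: algebra_simps)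
    finally show ?thesis by (simp add: M2)
  qed
  have bb: "norm b \<le> norm b' + norm v"
    using norm_triangle_ineq [of b' v] by (simp add: b'_def)
  \<comment> \<open>b' is at most M * |A b|, and A b is read off the first row.\<close>
  have \<beta>: "norm b' \<le> M\<^sup>2 * (norm r1 + norm a + norm c + \<mu> * norm b)"
  proof -
    have "A *v b = r1 - H *v a - G *v c - (A' - A) *v b"
      using eq1 by (auto simp: matrix_vector_mult_diff_rdistrib)
    then have "norm (A *v b) \<le> norm r1 + norm (H *v a) + norm (G *v c) + norm ((A' - A) *v b)"
      by (metis norm_diff4_le)
    also have "\<dots> \<le> norm r1 + M * norm a + M * norm c + M * (\<mu> * norm b)"
      by (intro add_mono order_refl norm_matrix_vector_mono H G near')
    also have "\<dots> \<le> M * (norm r1 + norm a + norm c + \<mu> * norm b)"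
      using mult_right_mono [OF M norm_ge_zero, of r1] by (simp add: algebra_simps)
    finally show ?thesis using v(2) Mm M2 by (metis order_trans)
  qed
  \<comment> \<open>As for b', with A^T a read off the second row, where \<open>D\<close>
    contributes only a multiple of \<mu> * |b|.\<close>
  have a': "norm a' \<le> M\<^sup>2 * (norm r2 + \<mu> * norm b + \<mu> * norm a)"
  proof -
    have "transpose A *v a = r2 + Db b - transpose (A' - A) *v a"
      using eq2 by (auto simp: Db_def transpose_diff matrix_vector_mult_diff_rdistrib)
    then have "norm (transpose A *v a) \<le> norm r2 + norm (Db b) + norm (transpose (A' - A) *v a)"
      by (metis norm_add_diff_le)
    also have "\<dots> \<le> norm r2 + M * (\<mu> * norm b) + M * (\<mu> * norm a)"
      using DbB [of b] near'(2) [of a] bB by fastforce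
    also have "\<dots> \<le> M * (norm r2 + \<mu> * norm b + \<mu> * norm a)"
      using mult_right_mono [OF M norm_ge_zero, of r2] by (simp add: algebra_simps)
    finally show ?thesis using w(2) Mm M2 unfolding a'_def by (metis order_trans)
  qed
  have aa: "norm a \<le> norm a' + norm w"
    using norm_triangle_ineq [of a' w] by (simp add: a'_def)
  \<comment> \<open>The first row is tested with w: since A^T w = 0, the term A b drops out and b
    survives only through A' - A; coercivity of H on the kernel then bounds w.\<close>
  have ww: "norm w \<le> M\<^sup>2 * (norm r1 + \<mu> * norm b + norm c + norm a')"
  proof -
    have "w \<bullet> (A *v b) = 0"
      using inner_transpose_mult [of b A w] w by (simp add: inner_commute)
    moreover have "H *v w = r1 - (A' - A) *v b - A *v b - G *v c - H *v a'"
      using eq1 by (auto simp: a'_def matrix_vector_mult_diff_rdistrib matrix_vector_mult_diff_distrib)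
    ultimately have eq: "w \<bullet> (H *v w) = w \<bullet> (r1 - (A' - A) *v b - G *v c - H *v a')"
      by (simp add: inner_diff_right)
    have "norm (r1 - (A' - A) *v b - G *v c - H *v a')
       \<le> norm r1 + norm ((A' - A) *v b) + norm (G *v c) + norm (H *v a')"
      by (rule norm_diff4_le)
    also have "\<dots> \<le> norm r1 + M * (\<mu> * norm b) + M * norm c + M * norm a'"
      by (intro add_mono order_refl norm_matrix_vector_mono H G near')
    also have "\<dots> \<le> M * (norm r1 + \<mu> * norm b + norm c + norm a')"
      using mult_right_mono [OF M norm_ge_zero, of r1] by (simp add: algebra_simps)
    finally have "w \<bullet> (H *v w) \<le> norm w * (M * (norm r1 + \<mu> * norm b + norm c + norm a'))"
      unfolding eq using abs_inner_le_mult abs_le_D1 by blast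
    from Mm [OF this] pos [OF w(1)]
    have "(norm w)\<^sup>2 \<le> (M\<^sup>2 * (norm r1 + \<mu> * norm b + norm c + norm a')) * norm w"
      by (simp add: power2_eq_square ac_simps)
    then show ?thesis
      by (rule le_of_square_le_mult) (use mu in auto)
  qed
  \<comment> \<open>The scalar lemma is used with P = M^2: one factor M comes from inverting (kernel
    distance, coercivity or \<open>D\<close>), the other from the sizes of the matrices.\<close>
  have M2': "1 \<le> M\<^sup>2" using M by simp
  note bound = saddle_scalar_bound [OF M2' less_imp_le [OF mu(1)] mu(2) norm_ge_zero norm_ge_zero norm_ge_zero norm_ge_zero norm_ge_zero norm_ge_zero norm_ge_zero norm_ge_zero norm_ge_zero norm_ge_zero
      c1 \<nu> bb \<beta> a' ww aa \<rho>]
  have "norm (b - v) \<le> K * \<rho>"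
    using bound(2) by (simp add: b'_def K)
  with bound v(1) show ?thesis unfolding K by blast
qed

section \<open>Derivatives of the Lagrangian\<close>

lemma grad_eqI:
  assumes "(f has_derivative (\<lambda>h. h \<bullet> D)) (at x)"
  shows "grad f x = D"
  unfolding grad_def gderiv_def
proof (rule the_equality)
  show "(f has_derivative (\<lambda>h. h \<bullet> D)) (at x)" by (rule assms)
next
  fix D' assume "(f has_derivative (\<lambda>h. h \<bullet> D')) (at x)"
  then have "(\<lambda>h. h \<bullet> D') = (\<lambda>h. h \<bullet> D)"
    using assms by (rule has_derivative_unique)
  then have "h \<bullet> D' = h \<bullet> D" for h by metis
  then show "D' = D" by (metis vector_eq_ldot)
qed

text \<open>Riesz representation: the derivative is the inner product with the value of its adjoint
  at 1, so the description in \<open>grad\<close> denotes a vector.\<close>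

lemma has_derivative_grad:
  fixes f :: "'a::euclidean_space \<Rightarrow> real"
  assumes "f differentiable (at x)"
  shows "(f has_derivative (\<lambda>h. h \<bullet> grad f x)) (at x)"
proof -
  obtain f' where f': "(f has_derivative f') (at x)"
    using assms by (auto simp: differentiable_def)
  have "linear f'" using f' by (rule has_derivative_linear)
  then have "f' = (\<lambda>h. h \<bullet> adjoint f' 1)"
    using adjoint_works [of f' _ 1] by (intro ext) simp
  then have "(f has_derivative (\<lambda>h. h \<bullet> adjoint f' 1)) (at x)"
    using f' by simp
  then show ?thesis using grad_eqI by metis
qed

lemma hess_eqI:
  assumes "(grad f has_derivative (\<lambda>h. A *v h)) (at x)"
  shows "hess f x = A"
proof -
  have "frechet_derivative (grad f) (at x) = (\<lambda>h. A *v h)"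
    using frechet_derivative_at [OF assms] by simp
  then show ?thesis by (simp add: hess_def jacobian_def)
qed

lemma has_derivative_hess:
  assumes "grad f differentiable (at x)"
  shows "(grad f has_derivative (\<lambda>h. hess f x *v h)) (at x)"
  using assms by (simp add: hess_def jacobian_works [symmetric])

lemma grad_linearization:
  fixes f :: "real^'n \<Rightarrow> real"
  assumes "grad f differentiable (at x)" "0 < e"
  shows "\<forall>\<^sub>F y in nhds x. norm (grad f y - grad f x - hess f x *v (y - x)) \<le> e * norm (y - x)"
proof -
  obtain d where "0 < d"
    "\<And>y. norm (y - x) < d \<Longrightarrow> norm (grad f y - grad f x - hess f x *v (y - x)) \<le> e * norm (y - x)"
    using has_derivative_hess [OF assms(1)] assms(2) unfolding has_derivative_at_alt by blast
  then show ?thesis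
    by (auto simp: eventually_nhds_metric dist_norm)
qed

lemma grad_lipschitz_at:
  fixes f :: "real^'n \<Rightarrow> real"
  assumes "grad f differentiable (at x)"
  shows "\<forall>\<^sub>F y in nhds x. norm (grad f y - grad f x) \<le> (1 + norm (hess f x)) * norm (y - x)"
  using grad_linearization [OF assms, of 1, simplified]
proof eventually_elim
  case (elim y)
  have "norm (grad f y - grad f x)
      \<le> norm (grad f y - grad f x - hess f x *v (y - x)) + norm (hess f x *v (y - x))"
    using norm_triangle_sub by (metis add.commute)
  also have "\<dots> \<le> 1 * norm (y - x) + norm (hess f x) * norm (y - x)"
    by (intro add_mono norm_matrix_vector_le) (use elim in simp)
  finally show ?case by (simp add: algebra_simps)
qed

text \<open>The gradient is only compared with its value at the centre x, which is enough: on the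
  ball of radius |y - x| about x the derivative deviates from that at x by at most L * |y - x|, and
  the mean value inequality turns this into a quadratic remainder.\<close>

lemma quadratic_remainder_at:
  fixes f :: "real^'n \<Rightarrow> real"
  assumes diff: "\<And>y. f differentiable (at y)" and "grad f differentiable (at x)"
  shows "\<forall>\<^sub>F y in nhds x. \<bar>f y - f x - (y - x) \<bullet> grad f x\<bar> \<le> (1 + norm (hess f x)) * (norm (y - x))\<^sup>2"
proof -
  define L where "L = 1 + norm (hess f x)"
  have L: "0 \<le> L" by (simp add: L_def)
  obtain r where r: "0 < r" "\<And>y. dist y x < r \<Longrightarrow> norm (grad f y - grad f x) \<le> L * norm (y - x)"
    using grad_lipschitz_at [OF assms(2)] unfolding eventually_nhds_metric L_def by blast
  have "\<bar>f y - f x - (y - x) \<bullet> grad f x\<bar> \<le> L * (norm (y - x))\<^sup>2" if "dist y x < r" for y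
  proof -
    have "norm (f y - f x - (y - x) \<bullet> grad f x) \<le> norm (y - x) * (L * norm (y - x))"
    proof (rule differentiable_bound_linearization [where S = "cball x (norm (y - x))"
          and f' = "\<lambda>p h. h \<bullet> grad f p" and ?x0.0 = x])
      show "x + t *\<^sub>R (y - x) \<in> cball x (norm (y - x))" if "t \<in> {0..1}" for t
        using that by (auto simp: dist_norm intro!: mult_left_le_one_le)
      show "(f has_derivative (\<lambda>h. h \<bullet> grad f p)) (at p within cball x (norm (y - x)))" for p
        using has_derivative_grad [OF diff] by (rule has_derivative_at_withinI)
      show "onorm ((\<lambda>h. h \<bullet> grad f p) - (\<lambda>h. h \<bullet> grad f x)) \<le> L * norm (y - x)"
        if "p \<in> cball x (norm (y - x))" for p
      proof (rule onorm_bound)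
        have p: "norm (p - x) \<le> norm (y - x)" using that by (simp add: dist_norm norm_minus_commute)
        then have "norm (grad f p - grad f x) \<le> L * norm (p - x)"
          using \<open>dist y x < r\<close> r(2) [of p] by (simp add: dist_norm)
        also have "\<dots> \<le> L * norm (y - x)" using p L by (rule mult_left_mono)
        finally have le: "norm (grad f p - grad f x) \<le> L * norm (y - x)" .
        fix h
        have "norm (((\<lambda>h. h \<bullet> grad f p) - (\<lambda>h. h \<bullet> grad f x)) h) = \<bar>h \<bullet> (grad f p - grad f x)\<bar>"
          by (simp add: inner_diff_right)
        also have "\<dots> \<le> norm h * (L * norm (y - x))"
          using Cauchy_Schwarz_ineq2 [of h "grad f p - grad f x"] mult_left_mono [OF le norm_ge_zero, of h]
          by linarith
        finally show "norm (((\<lambda>h. h \<bullet> grad f p) - (\<lambda>h. h \<bullet> grad f x)) h) \<le> L * norm (y - x) * norm h"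
          by (simp add: ac_simps)
      qed (use L in simp)
    qed simp
    then show ?thesis by (simp add: power2_eq_square ac_simps)
  qed
  then show ?thesis using r(1) by (auto simp: eventually_nhds_metric L_def)
qed

lemma hess_continuous:
  assumes "twice_lipschitz_diff f" "0 < e"
  shows "\<forall>\<^sub>F y in nhds x. norm (hess f y - hess f x) \<le> e"
proof -
  obtain r L where r: "0 < r" "L-lipschitz_on (ball x r) (hess f)"
    using assms(1) unfolding twice_lipschitz_diff_def by meson
  then have "continuous_on (ball x r) (hess f)" by (simp add: lipschitz_on_continuous_on)
  then have "isCont (hess f) x"
    using r(1) by (simp add: continuous_on_eq_continuous_at)
  then have "(hess f \<longlongrightarrow> hess f x) (nhds x)"
    unfolding isCont_def tendsto_at_iff_tendsto_nhds .
  then have "\<forall>\<^sub>F y in nhds x. dist (hess f y) (hess f x) < e"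
    using assms(2) by (rule tendstoD)
  then show ?thesis by eventually_elim (simp add: dist_norm)
qed

text \<open>The derivatives of the Lagrangian are affine in l; this turns bounds for the objective
  and for each constraint into one that is uniform over bounded l.\<close>

lemma norm_affine_sum_le:
  fixes F :: "'i::finite \<Rightarrow> 'b::real_normed_vector" and R e :: real
  assumes "norm F0 \<le> e" "\<And>i. norm (F i) \<le> e" "norm l \<le> R"
  shows "norm (F0 + (\<Sum>i\<in>UNIV. (l :: real^'i) $ i *\<^sub>R F i)) \<le> (1 + CARD('i) * R) * e"
proof -
  have "0 \<le> e" using assms(1) norm_ge_zero order_trans by blast
  have "0 \<le> R" using assms(3) norm_ge_zero order_trans by blast
  have "norm (l $ i *\<^sub>R F i) \<le> R * e" for i
    using component_le_norm_cart [of l i] assms(2) [of i] assms(3) \<open>0 \<le> R\<close>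
    by (auto intro!: mult_mono)
  then have "norm (\<Sum>i\<in>UNIV. l $ i *\<^sub>R F i) \<le> CARD('i) * (R * e)"
    by (intro sum_norm_bound) auto
  then show ?thesis
    using norm_triangle_ineq [of F0 "\<Sum>i\<in>UNIV. l $ i *\<^sub>R F i"] assms(1)
    by (simp add: distrib_right mult.assoc)
qed

lemma matrix_vector_mult_sum_rdistrib:
  fixes F :: "'i \<Rightarrow> real^'m^'n"
  shows "(\<Sum>i\<in>S. F i) *v x = (\<Sum>i\<in>S. F i *v x)"
  by (induction S rule: infinite_finite_induct) (auto simp: matrix_vector_mult_add_rdistrib)

context
  fixes \<phi> :: "real^'n \<Rightarrow> real" and g :: "real^'n \<Rightarrow> real^'m"
  assumes \<phi>: "twice_lipschitz_diff \<phi>" and g: "\<forall>i. twice_lipschitz_diff (\<lambda>z. g z $ i)"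
begin

lemma grad_lagr:
  "grad (\<lambda>z. lagr \<phi> g z l) = (\<lambda>z. grad \<phi> z + (\<Sum>i\<in>UNIV. l $ i *\<^sub>R grad (\<lambda>z. g z $ i) z))"
proof (rule ext, rule grad_eqI)
  fix z
  have "((\<lambda>z. \<phi> z + (\<Sum>i\<in>UNIV. l $ i * g z $ i)) has_derivative
     (\<lambda>h. h \<bullet> grad \<phi> z + (\<Sum>i\<in>UNIV. l $ i * (h \<bullet> grad (\<lambda>z. g z $ i) z)))) (at z)"
    using \<phi> g by (intro has_derivative_add has_derivative_sum has_derivative_mult_right has_derivative_grad)
      (auto simp: twice_lipschitz_diff_def)
  then show "((\<lambda>z. lagr \<phi> g z l) has_derivative
     (\<lambda>h. h \<bullet> (grad \<phi> z + (\<Sum>i\<in>UNIV. l $ i *\<^sub>R grad (\<lambda>z. g z $ i) z)))) (at z)"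
    by (simp add: lagr_def inner_vec_def [of l] inner_add_right inner_sum_right)
qed

lemma lagr_z_eq_sum:
  "lagr_z \<phi> g z l = grad \<phi> z + (\<Sum>i\<in>UNIV. l $ i *\<^sub>R grad (\<lambda>z. g z $ i) z)"
  by (simp add: lagr_z_def grad_lagr)

lemma lagr_z_eq: "lagr_z \<phi> g z l = grad \<phi> z + gradmat g z *v l"
  by (simp add: lagr_z_eq_sum vec_eq_iff matrix_vector_mult_def gradmat_def mult.commute)

lemma lagr_zz_eq:
  "lagr_zz \<phi> g z l = hess \<phi> z + (\<Sum>i\<in>UNIV. l $ i *\<^sub>R hess (\<lambda>z. g z $ i) z)"
  unfolding lagr_zz_def
proof (rule hess_eqI)
  have "((\<lambda>z. grad \<phi> z + (\<Sum>i\<in>UNIV. l $ i *\<^sub>R grad (\<lambda>z. g z $ i) z)) has_derivative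
     (\<lambda>h. hess \<phi> z *v h + (\<Sum>i\<in>UNIV. l $ i *\<^sub>R (hess (\<lambda>z. g z $ i) z *v h)))) (at z)"
    using \<phi> g by (intro has_derivative_add has_derivative_sum has_derivative_scaleR_right has_derivative_hess)
      (auto simp: twice_lipschitz_diff_def)
  moreover have "hess \<phi> z *v h + (\<Sum>i\<in>UNIV. l $ i *\<^sub>R (hess (\<lambda>z. g z $ i) z *v h))
     = (hess \<phi> z + (\<Sum>i\<in>UNIV. l $ i *\<^sub>R hess (\<lambda>z. g z $ i) z)) *v h" for h
    by (simp only: matrix_vector_mult_add_rdistrib matrix_vector_mult_sum_rdistrib scaleR_matrix_vector_assoc)
  ultimately show "(grad (\<lambda>z. lagr \<phi> g z l) has_derivative
     (\<lambda>h. (hess \<phi> z + (\<Sum>i\<in>UNIV. l $ i *\<^sub>R hess (\<lambda>z. g z $ i) z)) *v h)) (at z)"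
    unfolding grad_lagr by (simp only:)
qed

lemma lagr_zz_mult_vec:
  "lagr_zz \<phi> g z l *v h = hess \<phi> z *v h + (\<Sum>i\<in>UNIV. l $ i *\<^sub>R (hess (\<lambda>z. g z $ i) z *v h))"
  by (simp only: lagr_zz_eq matrix_vector_mult_add_rdistrib matrix_vector_mult_sum_rdistrib
      scaleR_matrix_vector_assoc)

lemma norm_lagr_zz_diff_le:
  "norm (lagr_zz \<phi> g z l - lagr_zz \<phi> g z l') \<le> (\<Sum>i\<in>UNIV. norm (hess (\<lambda>z. g z $ i) z)) * norm (l - l')"
proof -
  have "lagr_zz \<phi> g z l - lagr_zz \<phi> g z l' = (\<Sum>i\<in>UNIV. (l - l') $ i *\<^sub>R hess (\<lambda>z. g z $ i) z)"
    by (simp only: lagr_zz_eq sum_subtractf scaleR_diff_left vector_minus_component add_diff_cancel_left)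
  also have "norm \<dots> \<le> (\<Sum>i\<in>UNIV. norm (l - l') * norm (hess (\<lambda>z. g z $ i) z))"
  proof (rule sum_norm_le)
    fix i
    show "norm ((l - l') $ i *\<^sub>R hess (\<lambda>z. g z $ i) z) \<le> norm (l - l') * norm (hess (\<lambda>z. g z $ i) z)"
      unfolding norm_scaleR by (rule mult_right_mono [OF component_le_norm_cart norm_ge_zero])
  qed
  also have "\<dots> = (\<Sum>i\<in>UNIV. norm (hess (\<lambda>z. g z $ i) z)) * norm (l - l')"
    by (subst sum_distrib_left [symmetric]) (rule mult.commute)
  finally show ?thesis .
qed

lemma norm_lagr_zz_le:
  assumes "norm l \<le> R"
  shows "norm (lagr_zz \<phi> g z l) \<le> norm (hess \<phi> z) + (\<Sum>i\<in>UNIV. norm (hess (\<lambda>z. g z $ i) z)) * R"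
proof -
  have "norm (lagr_zz \<phi> g z l) \<le> norm (lagr_zz \<phi> g z 0) + norm (lagr_zz \<phi> g z l - lagr_zz \<phi> g z 0)"
    by (rule norm_triangle_sub)
  also have "\<dots> \<le> norm (hess \<phi> z) + (\<Sum>i\<in>UNIV. norm (hess (\<lambda>z. g z $ i) z)) * R"
    using norm_lagr_zz_diff_le [of z l 0]
      mult_left_mono [OF assms sum_nonneg [of UNIV "\<lambda>i. norm (hess (\<lambda>z. g z $ i) z)"]]
    by (fastforce simp: lagr_zz_eq [of z 0])
  finally show ?thesis .
qed

lemma lagr_z_linearization:
  assumes "0 < e"
  shows "\<forall>\<^sub>F z in nhds x. \<forall>l. norm l \<le> R \<longrightarrow>
    norm (lagr_z \<phi> g z l - lagr_z \<phi> g x l - lagr_zz \<phi> g x l *v (z - x)) \<le> e * norm (z - x)"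
proof -
  \<comment> \<open>e' cancels the factor of \<open>norm_affine_sum_le\<close>. The absolute value
    keeps the denominator positive when R is negative and no l qualifies.\<close>
  define e' where "e' = e / (1 + CARD('m) * \<bar>R\<bar>)"
  have pos: "0 < 1 + CARD('m) * \<bar>R\<bar>" by (simp add: add_pos_nonneg)
  then have e': "0 < e'" using assms by (simp add: e'_def)
  have "\<forall>\<^sub>F z in nhds x. norm (grad \<phi> z - grad \<phi> x - hess \<phi> x *v (z - x)) \<le> e' * norm (z - x)"
    using \<phi> e' by (intro grad_linearization) (auto simp: twice_lipschitz_diff_def)
  moreover have "\<forall>\<^sub>F z in nhds x. \<forall>i. norm (grad (\<lambda>z. g z $ i) z - grad (\<lambda>z. g z $ i) x
      - hess (\<lambda>z. g z $ i) x *v (z - x)) \<le> e' * norm (z - x)"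
    using g e' by (intro eventually_all_finite grad_linearization) (auto simp: twice_lipschitz_diff_def)
  ultimately show ?thesis
  proof eventually_elim
    case (elim z)
    show ?case
    proof (intro allI impI)
      fix l :: "real^'m" assume "norm l \<le> R"
      then have l: "norm l \<le> \<bar>R\<bar>" by linarith
      have eq: "lagr_z \<phi> g z l - lagr_z \<phi> g x l - lagr_zz \<phi> g x l *v h
        = (grad \<phi> z - grad \<phi> x - hess \<phi> x *v h) + (\<Sum>i\<in>UNIV. l $ i *\<^sub>R
          (grad (\<lambda>z. g z $ i) z - grad (\<lambda>z. g z $ i) x - hess (\<lambda>z. g z $ i) x *v h))" for h
        by (simp add: lagr_z_eq_sum lagr_zz_mult_vec scaleR_diff_right sum_subtractf)
      have "norm (lagr_z \<phi> g z l - lagr_z \<phi> g x l - lagr_zz \<phi> g x l *v (z - x))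
         \<le> (1 + CARD('m) * \<bar>R\<bar>) * (e' * norm (z - x))"
        unfolding eq using elim l by (intro norm_affine_sum_le) auto
      also have "\<dots> = e * norm (z - x)" using pos by (simp add: e'_def)
      finally show "norm (lagr_z \<phi> g z l - lagr_z \<phi> g x l - lagr_zz \<phi> g x l *v (z - x)) \<le> e * norm (z - x)" .
    qed
  qed
qed

lemma lagr_zz_continuous:
  assumes "0 < e"
  shows "\<forall>\<^sub>F z in nhds x. \<forall>l. norm l \<le> R \<longrightarrow> norm (lagr_zz \<phi> g z l - lagr_zz \<phi> g x l) \<le> e"
proof -
  define e' where "e' = e / (1 + CARD('m) * \<bar>R\<bar>)"
  have pos: "0 < 1 + CARD('m) * \<bar>R\<bar>" by (simp add: add_pos_nonneg)
  then have e': "0 < e'" using assms by (simp add: e'_def)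
  have "\<forall>\<^sub>F z in nhds x. norm (hess \<phi> z - hess \<phi> x) \<le> e'"
    using \<phi> e' by (rule hess_continuous)
  moreover have "\<forall>\<^sub>F z in nhds x. \<forall>i. norm (hess (\<lambda>z. g z $ i) z - hess (\<lambda>z. g z $ i) x) \<le> e'"
    using g e' by (intro eventually_all_finite hess_continuous) auto
  ultimately show ?thesis
  proof eventually_elim
    case (elim z)
    show ?case
    proof (intro allI impI)
      fix l :: "real^'m" assume "norm l \<le> R"
      then have l: "norm l \<le> \<bar>R\<bar>" by linarith
      have eq: "lagr_zz \<phi> g z l - lagr_zz \<phi> g x l = (hess \<phi> z - hess \<phi> x)
          + (\<Sum>i\<in>UNIV. l $ i *\<^sub>R (hess (\<lambda>z. g z $ i) z - hess (\<lambda>z. g z $ i) x))"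
        by (simp add: lagr_zz_eq scaleR_diff_right sum_subtractf)
      have "norm (lagr_zz \<phi> g z l - lagr_zz \<phi> g x l) \<le> (1 + CARD('m) * \<bar>R\<bar>) * e'"
        unfolding eq using elim l by (intro norm_affine_sum_le) auto
      also have "\<dots> = e" using pos by (simp add: e'_def)
      finally show "norm (lagr_zz \<phi> g z l - lagr_zz \<phi> g x l) \<le> e" .
    qed
  qed
qed

lemma lagr_z_lipschitz_at:
  "\<exists>L\<ge>0. \<forall>\<^sub>F z in nhds x. \<forall>l. norm l \<le> R \<longrightarrow>
    norm (lagr_z \<phi> g z l - lagr_z \<phi> g x l) \<le> L * norm (z - x)"
proof -
  define h where "h = norm (hess \<phi> x) + (\<Sum>i\<in>UNIV. norm (hess (\<lambda>z. g z $ i) x)) * \<bar>R\<bar>"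
  have "0 \<le> 1 + h" by (simp add: h_def sum_nonneg)
  moreover have "\<forall>\<^sub>F z in nhds x. \<forall>l. norm l \<le> R \<longrightarrow>
    norm (lagr_z \<phi> g z l - lagr_z \<phi> g x l) \<le> (1 + h) * norm (z - x)"
    using lagr_z_linearization [where e = 1 and R = R and x = x, simplified]
  proof eventually_elim
    case (elim z)
    show ?case
    proof (intro allI impI)
      fix l :: "real^'m" assume l: "norm l \<le> R"
      have "norm (lagr_z \<phi> g z l - lagr_z \<phi> g x l) \<le> norm (lagr_zz \<phi> g x l *v (z - x))
         + norm (lagr_z \<phi> g z l - lagr_z \<phi> g x l - lagr_zz \<phi> g x l *v (z - x))"
        by (rule norm_triangle_sub)
      also have "\<dots> \<le> h * norm (z - x) + norm (z - x)"
        using elim l unfolding h_def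
        by (intro add_mono norm_matrix_vector_mono norm_lagr_zz_le) auto
      finally show "norm (lagr_z \<phi> g z l - lagr_z \<phi> g x l) \<le> (1 + h) * norm (z - x)"
        by (simp add: distrib_right)
    qed
  qed
  ultimately show ?thesis by blast
qed

lemma gradmat_lipschitz_at:
  "\<exists>L\<ge>0. \<forall>\<^sub>F z in nhds x. norm (gradmat g z - gradmat g x) \<le> L * norm (z - x)"
proof (intro exI conjI)
  show "0 \<le> (\<Sum>i\<in>UNIV. 1 + norm (hess (\<lambda>z. g z $ i) x))" by (simp add: sum_nonneg)
  have "\<forall>\<^sub>F z in nhds x. \<forall>i. norm (grad (\<lambda>z. g z $ i) z - grad (\<lambda>z. g z $ i) x)
      \<le> (1 + norm (hess (\<lambda>z. g z $ i) x)) * norm (z - x)"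
    using g by (intro eventually_all_finite grad_lipschitz_at) (auto simp: twice_lipschitz_diff_def)
  then show "\<forall>\<^sub>F z in nhds x. norm (gradmat g z - gradmat g x)
      \<le> (\<Sum>i\<in>UNIV. 1 + norm (hess (\<lambda>z. g z $ i) x)) * norm (z - x)"
  proof eventually_elim
    case (elim z)
    have "norm (gradmat g z - gradmat g x)
       \<le> (\<Sum>j\<in>UNIV. norm (grad (\<lambda>z. g z $ j) z - grad (\<lambda>z. g z $ j) x))"
      using norm_matrix_le_sum_columns [of "gradmat g z - gradmat g x"]
      by (simp add: gradmat_def minus_vec_def)
    also have "\<dots> \<le> (\<Sum>i\<in>UNIV. (1 + norm (hess (\<lambda>z. g z $ i) x)) * norm (z - x))"
      using elim by (intro sum_mono) auto
    finally show ?case by (simp add: sum_distrib_right)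
  qed
qed

lemma constraint_quadratic_remainder_at:
  "\<exists>L\<ge>0. \<forall>\<^sub>F z in nhds x. norm (g z - g x - transpose (gradmat g x) *v (z - x)) \<le> L * (norm (z - x))\<^sup>2"
proof (intro exI conjI)
  show "0 \<le> (\<Sum>i\<in>UNIV. 1 + norm (hess (\<lambda>z. g z $ i) x))" by (simp add: sum_nonneg)
  have "\<forall>\<^sub>F z in nhds x. \<forall>i. \<bar>g z $ i - g x $ i - (z - x) \<bullet> grad (\<lambda>z. g z $ i) x\<bar>
      \<le> (1 + norm (hess (\<lambda>z. g z $ i) x)) * (norm (z - x))\<^sup>2"
    using g by (intro eventually_all_finite quadratic_remainder_at) (auto simp: twice_lipschitz_diff_def)
  then show "\<forall>\<^sub>F z in nhds x. norm (g z - g x - transpose (gradmat g x) *v (z - x))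
      \<le> (\<Sum>i\<in>UNIV. 1 + norm (hess (\<lambda>z. g z $ i) x)) * (norm (z - x))\<^sup>2"
  proof eventually_elim
    case (elim z)
    have comp: "(transpose (gradmat g x) *v h) $ i = h \<bullet> grad (\<lambda>z. g z $ i) x" for h i
      unfolding matrix_vector_mul_component by (simp add: transpose_def gradmat_def inner_commute)
    have "norm (g z - g x - transpose (gradmat g x) *v (z - x))
       \<le> (\<Sum>i\<in>UNIV. \<bar>(g z - g x - transpose (gradmat g x) *v (z - x)) $ i\<bar>)"
      by (rule norm_le_l1_cart)
    also have "\<dots> \<le> (\<Sum>i\<in>UNIV. (1 + norm (hess (\<lambda>z. g z $ i) x)) * (norm (z - x))\<^sup>2)"
      unfolding vector_minus_component comp using elim by (intro sum_mono) auto
    finally show ?case by (simp add: sum_distrib_right)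
  qed
qed

end

section \<open>Estimates at the iterates\<close>

declare transpose_matrix_vector [simp del] \<comment> \<open>it would rewrite \<open>A\<^sup>T x\<close> to a vector-matrix product\<close>

lemma transpose_gradmat_mult_nth:
  "(transpose (gradmat g x) *v h) $ i = h \<bullet> grad (\<lambda>z. g z $ i) x"
  unfolding matrix_vector_mul_component by (simp add: transpose_def gradmat_def inner_commute)

lemma finite_uniform_pos:
  fixes f :: "'i::finite \<Rightarrow> real"
  assumes "\<And>i. i \<in> I \<Longrightarrow> 0 < f i"
  shows "\<exists>\<theta>>0. \<forall>i\<in>I. \<theta> \<le> f i"
proof (intro exI conjI ballI)
  \<comment> \<open>Inserting 1 makes the minimum meaningful for empty I.\<close>
  show "0 < Min (insert 1 (f ` I))" using assms by simp
  show "Min (insert 1 (f ` I)) \<le> f i" if "i \<in> I" for i using that by simp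
qed

lemma infdist_lessD:
  assumes "infdist x S < e" "S \<noteq> {}"
  shows "\<exists>a\<in>S. dist x a < e"
  using assms by (simp add: infdist_notempty cINF_less_iff)

lemma norm_subvec_le_bound:
  fixes x :: "real^'m" and c :: real
  assumes "\<And>i. i \<in> I \<Longrightarrow> \<bar>x $ i\<bar> \<le> c" "0 \<le> c"
  shows "norm (subvec I x) \<le> CARD('m) * c"
proof -
  have "norm (subvec I x) \<le> (\<Sum>i\<in>UNIV. \<bar>subvec I x $ i\<bar>)" by (rule norm_le_l1_cart)
  also have "\<dots> \<le> CARD('m) * c"
    using assms by (intro sum_bounded_above) (simp add: subvec_def)
  finally show ?thesis .
qed

lemma subvec_diff: "subvec I (x - y) = subvec I x - subvec I y"
  by (simp add: subvec_def vec_eq_iff)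

text \<open>With D_i = s_i / l_i these are the hypotheses of \<open>saddle_estimate\<close> that
  depend on the iterate, under one constant M, together with the bounds on g z and 1 / l_i that
  control the right-hand side of the exact step.\<close>

definition step_bounds :: "(real^'n \<Rightarrow> real) \<Rightarrow> (real^'n \<Rightarrow> real^'m) \<Rightarrow> real^'n \<Rightarrow> real \<Rightarrow>
    real^'n \<Rightarrow> real^'m \<Rightarrow> real^'m \<Rightarrow> bool" where
  "step_bounds \<phi> g zs M z l s \<longleftrightarrow> (let B = active g zs; G = gradmat g z; \<mu> = mu l s in
     norm (submat UNIV B G - submat UNIV B (gradmat g zs)) \<le> M * \<mu> \<and>
     norm G \<le> M \<and> norm (lagr_zz \<phi> g z l) \<le> M \<and> norm (g z) \<le> M \<and> norm (subvec B (g z)) \<le> M * \<mu> \<and>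
     (\<forall>w. transpose (submat UNIV B (gradmat g zs)) *v w = 0 \<longrightarrow>
       (norm w)\<^sup>2 \<le> M * (w \<bullet> (lagr_zz \<phi> g z l *v w))) \<and>
     (\<forall>i\<in>B. \<mu> \<le> M * (s $ i / l $ i) \<and> s $ i / l $ i \<le> M * \<mu> \<and> 1 / l $ i \<le> M) \<and>
     (\<forall>i\<in>-B. 1 \<le> M * \<mu> * (s $ i / l $ i) \<and> \<mu> * (1 / l $ i) \<le> M))"

text \<open>The quantifier prefix ``there is \<open>\<epsilon> > 0\<close> such that for all admissible iterates with
  \<open>\<delta>(z, \<lambda>) \<le> \<epsilon>\<close> and \<open>\<mu> \<le> \<epsilon>\<close>'' is encoded as a filter.\<close>

definition iterates :: "(real^'n \<Rightarrow> real) \<Rightarrow> (real^'n \<Rightarrow> real^'m) \<Rightarrow> real \<Rightarrow> real \<Rightarrow> real^'n \<Rightarrow>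
    ((real^'n) \<times> (real^'m) \<times> (real^'m)) filter" where
  "iterates \<phi> g C \<gamma> zs = (INF \<epsilon>\<in>{0<..}. principal {(z, l, s). iterate_ok \<phi> g C \<gamma> z l s \<and>
     infdist (z, l) ({zs} \<times> multipliers \<phi> g zs) \<le> \<epsilon> \<and> mu l s \<le> \<epsilon>})"

lemma eventually_iterates:
  "(\<forall>\<^sub>F (z, l, s) in iterates \<phi> g C \<gamma> zs. P z l s) \<longleftrightarrow>
    (\<exists>\<epsilon>>0. \<forall>z l s. iterate_ok \<phi> g C \<gamma> z l s \<and>
      infdist (z, l) ({zs} \<times> multipliers \<phi> g zs) \<le> \<epsilon> \<and> mu l s \<le> \<epsilon> \<longrightarrow> P z l s)"
  unfolding iterates_def
proof (subst eventually_INF_base)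
  fix a b :: real assume "a \<in> {0<..}" "b \<in> {0<..}"
  then show "\<exists>x\<in>{0<..}.
     principal {(z, l, s). iterate_ok \<phi> g C \<gamma> z l s \<and>
       infdist (z, l) ({zs} \<times> multipliers \<phi> g zs) \<le> x \<and> mu l s \<le> x}
     \<le> inf (principal {(z, l, s). iterate_ok \<phi> g C \<gamma> z l s \<and>
         infdist (z, l) ({zs} \<times> multipliers \<phi> g zs) \<le> a \<and> mu l s \<le> a})
       (principal {(z, l, s). iterate_ok \<phi> g C \<gamma> z l s \<and>
         infdist (z, l) ({zs} \<times> multipliers \<phi> g zs) \<le> b \<and> mu l s \<le> b})"
    by (intro bexI [of _ "min a b"]) auto
qed (auto simp: eventually_principal Bex_def)

lemma mu_pos:
  assumes "iterate_ok \<phi> g C \<gamma> z (l :: real^'m) s"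
  shows "0 < mu l s"
  unfolding mu_def inner_vec_def using assms
  by (intro divide_pos_pos sum_pos) (auto simp: iterate_ok_def)

lemma complementarity_le:
  assumes "iterate_ok \<phi> g C \<gamma> z (l :: real^'m) s"
  shows "l $ i * s $ i \<le> CARD('m) * mu l s"
proof -
  have "l $ i * s $ i \<le> (\<Sum>i\<in>UNIV. l $ i * s $ i)"
    using assms by (intro member_le_sum) (auto simp: iterate_ok_def less_imp_le)
  then show ?thesis by (simp add: mu_def inner_vec_def)
qed

context
  fixes \<phi> :: "real^'n \<Rightarrow> real" and g :: "real^'n \<Rightarrow> real^'m" and zs :: "real^'n" and C \<gamma> :: real
  assumes \<phi>: "twice_lipschitz_diff \<phi>" and g: "\<forall>i. twice_lipschitz_diff (\<lambda>z. g z $ i)"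
    and mult: "multipliers \<phi> g zs \<noteq> {}"
    and mfcq: "mfcq g zs" and sosc: "second_order_cond \<phi> g zs" and sc: "strict_complementarity \<phi> g zs"
    and C: "0 < C" and \<gamma>: "0 < \<gamma>"
begin

private abbreviation (input) "B \<equiv> active g zs"
private abbreviation (input) "A \<equiv> submat UNIV B (gradmat g zs)"
private abbreviation (input) "F \<equiv> iterates \<phi> g C \<gamma> zs"

section \<open>The multiplier set and the critical subspace\<close>

lemma multiplier_zero_inactive:
  assumes "l \<in> multipliers \<phi> g zs" "i \<notin> B"
  shows "l $ i = 0"
proof -
  have l: "\<And>i. g zs $ i \<le> 0" "\<And>i. 0 \<le> l $ i" "(\<Sum>i\<in>UNIV. l $ i * g zs $ i) = 0"
    using assms(1) by (auto simp: multipliers_def kkt_def inner_vec_def)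
  have "(\<Sum>i\<in>UNIV. - (l $ i * g zs $ i)) = 0" using l(3) by (simp add: sum_negf)
  then have "l $ i * g zs $ i = 0"
    using l by (subst (asm) sum_nonneg_eq_0_iff) (auto simp: mult_nonneg_nonpos)
  then show ?thesis using assms(2) by (simp add: active_def)
qed

text \<open>Pairing stationarity with the MFCQ direction y gives the combination of the l_i with
  weights c i the same value for every multiplier; the weights are positive on the active set, so
  each l_i is bounded.\<close>

lemma multipliers_bounded: "\<exists>R. \<forall>l\<in>multipliers \<phi> g zs. norm l \<le> R"
proof -
  obtain y where y: "\<And>i. i \<in> B \<Longrightarrow> grad (\<lambda>x. g x $ i) zs \<bullet> y < 0"
    using mfcq by (auto simp: mfcq_def)
  define c where "c i = - (grad (\<lambda>x. g x $ i) zs \<bullet> y)" for i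
  have c: "i \<in> B \<Longrightarrow> 0 < c i" for i using y by (simp add: c_def)
  show ?thesis
  proof (intro exI ballI)
    fix l assume l: "l \<in> multipliers \<phi> g zs"
    then have l0: "lagr_z \<phi> g zs l = 0" "\<And>i. 0 \<le> l $ i"
      by (auto simp: multipliers_def kkt_def)
    have "0 = lagr_z \<phi> g zs l \<bullet> y" using l0 by simp
    also have "\<dots> = grad \<phi> zs \<bullet> y - (\<Sum>i\<in>UNIV. l $ i * c i)"
      by (simp add: lagr_z_eq_sum [OF \<phi> g] inner_add_left inner_sum_left c_def sum_negf)
    finally have eq: "(\<Sum>i\<in>UNIV. l $ i * c i) = grad \<phi> zs \<bullet> y" by simp
    have nonneg: "0 \<le> l $ i * c i" for i
      using c [of i] l0(2) [of i] multiplier_zero_inactive [OF l, of i] by (cases "i \<in> B") auto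
    \<comment> \<open>For inactive i the sign of c i is unknown and the quotient is arbitrary, but
      l_i = 0 there.\<close>
    have "\<bar>l $ i\<bar> \<le> \<bar>grad \<phi> zs \<bullet> y / c i\<bar>" for i
    proof (cases "i \<in> B")
      case True
      have "l $ i * c i \<le> grad \<phi> zs \<bullet> y"
        unfolding eq [symmetric] using nonneg by (intro member_le_sum) auto
      then have "l $ i \<le> grad \<phi> zs \<bullet> y / c i" using c [OF True] by (simp add: field_simps)
      then show ?thesis using l0(2) [of i] by linarith
    qed (use multiplier_zero_inactive [OF l] in auto)
    then have "(\<Sum>i\<in>UNIV. \<bar>l $ i\<bar>) \<le> (\<Sum>i\<in>UNIV. \<bar>grad \<phi> zs \<bullet> y / c i\<bar>)"
      by (intro sum_mono)
    then show "norm l \<le> (\<Sum>i\<in>UNIV. \<bar>grad \<phi> zs \<bullet> y / c i\<bar>)"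
      using norm_le_l1_cart [of l] by linarith
  qed
qed

text \<open>Strict complementarity turns the cone of the second-order condition into the subspace
  ker A^T, hence the condition into coercivity on that kernel.\<close>

lemma strongly_active_eq: "strongly_active \<phi> g zs = B"
  using sc by (auto simp: strongly_active_def strict_complementarity_def)

lemma kernel_iff: "transpose A *v w = 0 \<longleftrightarrow> (\<forall>i\<in>B. grad (\<lambda>x. g x $ i) zs \<bullet> w = 0)"
  by (auto simp: transpose_submat_mult_vec vec_eq_iff subvec_def transpose_gradmat_mult_nth inner_commute)

lemma hessian_pos_on_kernel:
  "\<exists>\<xi>>0. \<forall>l\<in>multipliers \<phi> g zs. \<forall>w. transpose A *v w = 0 \<longrightarrow>
     \<xi> * (norm w)\<^sup>2 \<le> w \<bullet> (lagr_zz \<phi> g zs l *v w)"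
  using sosc unfolding second_order_cond_def strongly_active_eq kernel_iff by simp

section \<open>Limits of multipliers and slacks along \<open>iterates\<close>\<close>

lemma eventually_iterate_ok:
  "\<forall>\<^sub>F (z, l, s) in F. iterate_ok \<phi> g C \<gamma> z l s"
  unfolding eventually_iterates by (intro exI [of _ 1]) auto

lemma eventually_mu_le:
  assumes "0 < e"
  shows "\<forall>\<^sub>F (z, l, s) in F. mu l s \<le> e"
  unfolding eventually_iterates using assms by auto

lemma eventually_near:
  assumes "0 < e"
  shows "\<forall>\<^sub>F (z, l, s) in F. dist z zs < e \<and> (\<exists>l'\<in>multipliers \<phi> g zs. norm (l - l') < e)"
  unfolding eventually_iterates
\<comment> \<open>Halving e makes the inequality strict, so a nearby point of the solution set
  exists without attainment of the distance.\<close>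
proof (intro exI [of _ "e / 2"] conjI allI impI)
  show "0 < e / 2" using assms by simp
  fix z l s
  assume *: "iterate_ok \<phi> g C \<gamma> z l s \<and> infdist (z, l) ({zs} \<times> multipliers \<phi> g zs) \<le> e / 2 \<and> mu l s \<le> e / 2"
  then have "infdist (z, l) ({zs} \<times> multipliers \<phi> g zs) < e" using assms by simp
  then obtain l' where l': "l' \<in> multipliers \<phi> g zs" "dist (z, l) (zs, l') < e"
    using infdist_lessD mult by blast
  show "dist z zs < e"
    using dist_fst_le [of "(z, l)" "(zs, l')"] l'(2) by simp
  show "\<exists>l'\<in>multipliers \<phi> g zs. norm (l - l') < e"
    using dist_snd_le [of "(z, l)" "(zs, l')", simplified] l' unfolding dist_norm [symmetric]
    by (meson le_less_trans)
qed

lemma eventually_nhds_iterates: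
  assumes "\<forall>\<^sub>F z in nhds zs. P z"
  shows "\<forall>\<^sub>F (z, l, s) in F. P z"
proof -
  obtain d where d: "0 < d" "\<And>z. dist z zs < d \<Longrightarrow> P z"
    using assms by (auto simp: eventually_nhds_metric)
  show ?thesis using eventually_near [OF d(1)] by eventually_elim (use d(2) in auto)
qed

lemma eventually_multiplier_bounded: "\<exists>R. \<forall>\<^sub>F (z, l, s) in F. norm l \<le> R"
proof -
  obtain R where R: "\<And>l. l \<in> multipliers \<phi> g zs \<Longrightarrow> norm l \<le> R"
    using multipliers_bounded by blast
  have le: "norm l \<le> R + 1" if "l' \<in> multipliers \<phi> g zs" "norm (l - l') < 1" for l l'
    using R [OF that(1)] that(2) norm_triangle_sub [of l l'] by linarith
  have "\<forall>\<^sub>F (z, l, s) in F. norm l \<le> R + 1"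
    using eventually_near [of 1, simplified] by eventually_elim (use le in auto)
  then show ?thesis by blast
qed

lemma constraint_continuous:
  assumes "0 < e"
  shows "\<forall>\<^sub>F z in nhds zs. norm (g z - g zs) < e"
proof -
  have "((\<lambda>z. g z $ i) \<longlongrightarrow> g zs $ i) (nhds zs)" for i
  proof -
    have "(\<lambda>z. g z $ i) differentiable (at zs)"
      using g by (simp add: twice_lipschitz_diff_def)
    then have "isCont (\<lambda>z. g z $ i) zs" by (rule differentiable_imp_continuous_within)
    then show ?thesis by (simp add: isCont_def tendsto_at_iff_tendsto_nhds [of "\<lambda>z. g z $ i"])
  qed
  then have "(g \<longlongrightarrow> g zs) (nhds zs)" by (rule vec_tendstoI)
  from tendstoD [OF this assms] show ?thesis by (simp add: dist_norm)
qed

text \<open>The slacks tend to -g zs, because g z + s is of order \<mu> and g is continuous.\<close>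

lemma eventually_slack_near:
  assumes "0 < e"
  shows "\<forall>\<^sub>F (z, l, s) in F. norm (s + g zs) \<le> e"
proof -
  have "0 < e / 2" "0 < e / 2 / C" using assms C by simp_all
  from eventually_nhds_iterates [OF constraint_continuous [OF this(1)]] eventually_mu_le [OF this(2)]
    eventually_iterate_ok
  show ?thesis
  proof eventually_elim
    case (elim p)
    obtain z l s where p: "p = (z, l, s)" by (cases p)
    note el = elim [unfolded p prod.case]
    have "norm (g z + s) \<le> C * mu l s" using el(3) by (simp add: iterate_ok_def)
    also have "\<dots> \<le> e / 2" using el(2) C by (simp add: field_simps)
    finally have "norm (g z + s) \<le> e / 2" .
    moreover have "norm (s + g zs) = norm ((g z + s) - (g z - g zs))" by simp
    ultimately have "norm (s + g zs) \<le> e"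
      using norm_triangle_ineq4 [of "g z + s" "g z - g zs"] el(1) by linarith
    then show ?case by (simp add: p)
  qed
qed

lemma eventually_slack_bounded: "\<forall>\<^sub>F (z, l, s) in F. norm s \<le> norm (g zs) + 1"
  using eventually_slack_near [of 1, simplified]
proof eventually_elim
  case (elim p)
  then show ?case using norm_triangle_sub [of "snd (snd p)" "- g zs"] by (auto split: prod.splits)
qed

lemma eventually_slack_inactive: "\<exists>\<sigma>>0. \<forall>\<^sub>F (z, l, s) in F. \<forall>i\<in>-B. \<sigma> \<le> s $ i"
proof -
  obtain l0 where "l0 \<in> multipliers \<phi> g zs" using mult by blast
  then have "g zs $ i \<le> 0" for i by (simp add: multipliers_def kkt_def)
  then have "i \<in> - B \<Longrightarrow> 0 < - g zs $ i" for i by (auto simp: active_def order_less_le)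
  then obtain \<sigma> where \<sigma>: "0 < \<sigma>" "\<And>i. i \<in> - B \<Longrightarrow> \<sigma> \<le> - g zs $ i"
    using finite_uniform_pos [of "- B" "\<lambda>i. - g zs $ i"] by auto
  have "\<forall>\<^sub>F (z, l, s) in F. norm (s + g zs) \<le> \<sigma> / 2"
    using \<sigma>(1) by (intro eventually_slack_near) simp
  then have "\<forall>\<^sub>F (z, l, s) in F. \<forall>i\<in>-B. \<sigma> / 2 \<le> s $ i"
  proof eventually_elim
    case (elim p)
    have "\<sigma> / 2 \<le> s $ i" if "norm (s + g zs) \<le> \<sigma> / 2" "i \<in> - B" for s i
      using that(1) \<sigma>(2) [OF that(2)] component_le_norm_cart [of "s + g zs" i] by simp
    then show ?case using elim by auto
  qed
  then show ?thesis using \<sigma>(1) half_gt_zero by blast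
qed

text \<open>The product l_i s_i is at most m * \<mu>, while the slack stays above a positive
  constant.\<close>

lemma eventually_multiplier_inactive:
  "\<exists>K>0. \<forall>\<^sub>F (z, l, s) in F. \<forall>i\<in>-B. l $ i \<le> K * mu l s"
proof -
  obtain \<sigma> where \<sigma>: "0 < \<sigma>" "\<forall>\<^sub>F (z, l, s) in F. \<forall>i\<in>-B. \<sigma> \<le> s $ i"
    using eventually_slack_inactive by blast
  from \<sigma>(2) eventually_iterate_ok
  have "\<forall>\<^sub>F (z, l, s) in F. \<forall>i\<in>-B. l $ i \<le> (CARD('m) / \<sigma>) * mu l s"
  proof eventually_elim
    case (elim p)
    obtain z l s where p: "p = (z, l, s)" by (cases p)
    note el = elim [unfolded p prod.case]
    have "l $ i \<le> (CARD('m) / \<sigma>) * mu l s" if "i \<in> - B" for i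
    proof -
      have "\<sigma> * l $ i \<le> s $ i * l $ i"
        using el that by (intro mult_right_mono) (auto simp: iterate_ok_def less_imp_le)
      also have "\<dots> \<le> CARD('m) * mu l s"
        using complementarity_le [OF el(2), of i] by (simp add: mult.commute)
      finally show ?thesis using \<sigma>(1) by (simp add: field_simps)
    qed
    then show ?case by (simp add: p)
  qed
  then show ?thesis using \<sigma>(1) by (intro exI [of _ "CARD('m) / \<sigma>"]) auto
qed

lemma pos_on_kernel_perturb:
  fixes H H' :: "real^'n^'n"
  assumes "\<xi> * (norm w)\<^sup>2 \<le> w \<bullet> (H *v w)" "norm (H' - H) \<le> e"
  shows "(\<xi> - e) * (norm w)\<^sup>2 \<le> w \<bullet> (H' *v w)"
proof -
  have arith: "(\<xi> - e) * n\<^sup>2 \<le> r" if "\<xi> * n\<^sup>2 \<le> p" "\<bar>q\<bar> \<le> n * (e * n)" "r = p + q" for n p q r :: real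
    using that by (simp add: algebra_simps power2_eq_square)
  show ?thesis
  proof (rule arith)
    show "\<bar>w \<bullet> ((H' - H) *v w)\<bar> \<le> norm w * (e * norm w)"
      by (intro abs_inner_le_mult norm_matrix_vector_mono assms)
    show "w \<bullet> (H' *v w) = w \<bullet> (H *v w) + w \<bullet> ((H' - H) *v w)"
      by (simp add: matrix_vector_mult_diff_rdistrib inner_diff_right)
  qed (rule assms)
qed

text \<open>Half of the constant \<xi> remains: one quarter pays for the distance of l to a true
  multiplier, one for that of z to zs. The version at zs serves the estimate of z - zs, the version
  at z the step equations.\<close>

lemma eventually_hessian_pos:
  "\<exists>\<alpha>>0. \<forall>\<^sub>F (z, l, s) in F. \<forall>w. transpose A *v w = 0 \<longrightarrow>
     \<alpha> * (norm w)\<^sup>2 \<le> w \<bullet> (lagr_zz \<phi> g zs l *v w) \<and> \<alpha> * (norm w)\<^sup>2 \<le> w \<bullet> (lagr_zz \<phi> g z l *v w)"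
proof -
  obtain \<xi> where \<xi>: "0 < \<xi>" "\<And>l w. l \<in> multipliers \<phi> g zs \<Longrightarrow> transpose A *v w = 0 \<Longrightarrow>
     \<xi> * (norm w)\<^sup>2 \<le> w \<bullet> (lagr_zz \<phi> g zs l *v w)"
    using hessian_pos_on_kernel by blast
  obtain R where R: "\<forall>\<^sub>F (z, l, s) in F. norm l \<le> R"
    using eventually_multiplier_bounded by blast
  \<comment> \<open>The summand 1 allows division by h even if all constraint Hessians
    vanish.\<close>
  define h where "h = 1 + (\<Sum>i\<in>UNIV. norm (hess (\<lambda>z. g z $ i) zs))"
  have h: "0 < h" by (simp add: h_def add_pos_nonneg sum_nonneg)
  have "0 < \<xi> / 4 / h" "0 < \<xi> / 4" using \<xi>(1) h by simp_all
  from eventually_near [OF this(1)] R eventually_nhds_iterates [OF lagr_zz_continuous [OF \<phi> g this(2), where R = R]]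
  have "\<forall>\<^sub>F (z, l, s) in F. \<forall>w. transpose A *v w = 0 \<longrightarrow>
     \<xi> / 2 * (norm w)\<^sup>2 \<le> w \<bullet> (lagr_zz \<phi> g zs l *v w) \<and> \<xi> / 2 * (norm w)\<^sup>2 \<le> w \<bullet> (lagr_zz \<phi> g z l *v w)"
  proof eventually_elim
    case (elim p)
    obtain z l s where p: "p = (z, l, s)" by (cases p)
    note el = elim [unfolded p prod.case]
    obtain l' where l': "l' \<in> multipliers \<phi> g zs" "norm (l - l') < \<xi> / 4 / h" using el(1) by blast
    have "norm (lagr_zz \<phi> g zs l - lagr_zz \<phi> g zs l') \<le> h * norm (l - l')"
      using norm_lagr_zz_diff_le [OF \<phi> g, of zs l l'] by (simp add: h_def distrib_right add_increasing)
    also have "\<dots> \<le> \<xi> / 4"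
      using l'(2) h by (simp add: field_simps)
    finally have 1: "norm (lagr_zz \<phi> g zs l - lagr_zz \<phi> g zs l') \<le> \<xi> / 4" .
    have 2: "norm (lagr_zz \<phi> g z l - lagr_zz \<phi> g zs l) \<le> \<xi> / 4" using el(2,3) by blast
    have "\<xi> / 2 * (norm w)\<^sup>2 \<le> w \<bullet> (lagr_zz \<phi> g zs l *v w) \<and> \<xi> / 2 * (norm w)\<^sup>2 \<le> w \<bullet> (lagr_zz \<phi> g z l *v w)"
      if w: "transpose A *v w = 0" for w
    proof -
      note 3 = pos_on_kernel_perturb [OF \<xi>(2) [OF l'(1) w] 1]
      have "\<xi> / 2 * (norm w)\<^sup>2 \<le> (\<xi> - \<xi> / 4) * (norm w)\<^sup>2"
        using \<xi>(1) by (intro mult_right_mono) auto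
      with 3 pos_on_kernel_perturb [OF 3 2] show ?thesis by simp
    qed
    then show ?case unfolding p prod.case by blast
  qed
  then show ?thesis using \<xi>(1) half_gt_zero by blast
qed


text \<open>A strictly complementary multiplier \<open>\<lambda>\<close> bounds the active slacks through \<open>s\<^sup>T \<lambda>\<close>, which is controlled by
  testing the dual residual with \<open>z - z\<^sup>*\<close>.\<close>

lemma eventually_slack_active:
  "\<exists>K>0. \<forall>\<^sub>F (z, l, s) in F. \<forall>i\<in>B. s $ i \<le> K * (mu l s + (norm (z - zs))\<^sup>2)"
proof -
  obtain lb where lb: "lb \<in> multipliers \<phi> g zs" "\<And>i. i \<in> B \<Longrightarrow> 0 < lb $ i"
    using sc by (auto simp: strict_complementarity_def)
  have kkt: "lagr_z \<phi> g zs lb = 0" "\<And>i. g zs $ i \<le> 0" "\<And>i. 0 \<le> lb $ i" "lb \<bullet> g zs = 0"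
    using lb(1) by (auto simp: multipliers_def kkt_def)
  obtain \<theta> where \<theta>: "0 < \<theta>" "\<And>i. i \<in> B \<Longrightarrow> \<theta> \<le> lb $ i"
    using finite_uniform_pos [of B "\<lambda>i. lb $ i"] lb(2) by blast
  obtain R where R: "\<forall>\<^sub>F (z, l, s) in F. norm l \<le> R"
    using eventually_multiplier_bounded by blast
  obtain L1 where L1: "0 \<le> L1" "\<forall>\<^sub>F z in nhds zs. \<forall>l. norm l \<le> R \<longrightarrow>
      norm (lagr_z \<phi> g z l - lagr_z \<phi> g zs l) \<le> L1 * norm (z - zs)"
    using lagr_z_lipschitz_at [OF \<phi> g] by blast
  obtain L2 where L2: "0 \<le> L2"
      "\<forall>\<^sub>F z in nhds zs. norm (g z - g zs - transpose (gradmat g zs) *v (z - zs)) \<le> L2 * (norm (z - zs))\<^sup>2"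
    using constraint_quadratic_remainder_at [OF \<phi> g] by blast
  define Rt where "Rt = \<bar>R\<bar> + norm lb"
  define K where "K = CARD('m) + C + L1 + Rt * L2 + Rt * C"
  have Rt: "0 \<le> Rt" by (simp add: Rt_def)
  have K: "0 < K" using C L1(1) L2(1) Rt by (simp add: K_def add_nonneg_pos add_pos_nonneg)
  have arith: "x \<le> K * (m + n\<^sup>2)"
    if "x = CARD('m) * m + (p - q + r) + v - w" "\<bar>p\<bar> \<le> n * (C * m)" "\<bar>q\<bar> \<le> n * (L1 * n)"
      "\<bar>r\<bar> \<le> Rt * (L2 * n\<^sup>2)" "\<bar>w\<bar> \<le> Rt * (C * m)" "v \<le> 0" "n \<le> 1" "0 \<le> m" "0 \<le> n"
    for x m p q r v w n :: real
  proof -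
    have "n * (C * m) \<le> C * m" using that C by (simp add: mult_left_le_one_le)
    then have "x \<le> (CARD('m) + C + Rt * C) * m + (L1 + Rt * L2) * n\<^sup>2"
      using that by (simp add: algebra_simps power2_eq_square)
    also have "\<dots> \<le> K * m + K * n\<^sup>2"
    proof -
      have "0 \<le> Rt * L2" "0 \<le> Rt * C" using Rt L2(1) C by simp_all
      then have "CARD('m) + C + Rt * C \<le> K" "L1 + Rt * L2 \<le> K"
        using C L1(1) by (simp_all add: K_def)
      then show ?thesis using that by (meson add_mono mult_right_mono zero_le_power2)
    qed
    finally show ?thesis by (simp add: distrib_left)
  qed
  from R eventually_iterate_ok eventually_nhds_iterates [OF L1(2)] eventually_nhds_iterates [OF L2(2)]
    eventually_near [of 1, simplified]
  have "\<forall>\<^sub>F (z, l, s) in F. \<forall>i\<in>B. s $ i \<le> (K / \<theta>) * (mu l s + (norm (z - zs))\<^sup>2)"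
  proof eventually_elim
    case (elim p)
    obtain z l s where p: "p = (z, l, s)" by (cases p)
    note el = elim [unfolded p prod.case]
    have ok: "norm (lagr_z \<phi> g z l) \<le> C * mu l s" "norm (g z + s) \<le> C * mu l s"
      "\<And>i. 0 < l $ i" "\<And>i. 0 < s $ i"
      using el(2) by (auto simp: iterate_ok_def)
    have lagr: "lagr_z \<phi> g zs l = gradmat g zs *v (l - lb)"
      using kkt(1) by (simp add: lagr_z_eq [OF \<phi> g] matrix_vector_mult_diff_distrib eq_neg_iff_add_eq_0 [symmetric])
    define d where "d = z - zs"
    define e where "e = g z - g zs - transpose (gradmat g zs) *v d"
    have l_lb: "norm (l - lb) \<le> Rt"
      using el(1) norm_triangle_ineq4 [of l lb] by (simp add: Rt_def)
    \<comment> \<open>Write s . lb = s . l - s . (l - lb) and s = (g z + s) - g z. As lb is a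
      multiplier, \<open>lagr_z\<close> at (zs, l) is the gradient matrix applied to l - lb, so the
      linear part of g z - g zs, paired with l - lb, is d paired with \<open>lagr_z\<close> at (zs,
      l), which is the dual residual up to a term in |d|^2. The leftover g zs . l is
      nonpositive.\<close>
    have "s \<bullet> lb \<le> K * (mu l s + (norm d)\<^sup>2)"
    proof (rule arith)
      have "CARD('m) * mu l s = l \<bullet> s" by (simp add: mu_def)
      moreover have "(transpose (gradmat g zs) *v d) \<bullet> (l - lb) = d \<bullet> lagr_z \<phi> g zs l"
        using inner_transpose_mult [of "l - lb" "gradmat g zs" d] by (simp add: lagr inner_commute)
      then have "d \<bullet> lagr_z \<phi> g z l - d \<bullet> (lagr_z \<phi> g z l - lagr_z \<phi> g zs l) + (l - lb) \<bullet> e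
         = (g z - g zs) \<bullet> (l - lb)"
        unfolding e_def inner_commute [of "l - lb"] by (simp add: inner_diff_left inner_diff_right)
      ultimately show "s \<bullet> lb = CARD('m) * mu l s + (d \<bullet> lagr_z \<phi> g z l
          - d \<bullet> (lagr_z \<phi> g z l - lagr_z \<phi> g zs l) + (l - lb) \<bullet> e) + g zs \<bullet> l - (l - lb) \<bullet> (g z + s)"
        using kkt(4) by (simp add: inner_diff_left inner_diff_right inner_add_right inner_commute)
      show "\<bar>d \<bullet> lagr_z \<phi> g z l\<bar> \<le> norm d * (C * mu l s)"
        by (rule abs_inner_le_mult [OF ok(1)])
      show "\<bar>d \<bullet> (lagr_z \<phi> g z l - lagr_z \<phi> g zs l)\<bar> \<le> norm d * (L1 * norm d)"
        unfolding d_def using el(1,3) by (intro abs_inner_le_mult) blast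
      have "norm e \<le> L2 * (norm d)\<^sup>2" using el(4) by (simp add: e_def d_def)
      then have "\<bar>(l - lb) \<bullet> e\<bar> \<le> norm (l - lb) * (L2 * (norm d)\<^sup>2)"
        by (rule abs_inner_le_mult)
      also have "\<dots> \<le> Rt * (L2 * (norm d)\<^sup>2)"
        using l_lb L2(1) by (intro mult_right_mono) auto
      finally show "\<bar>(l - lb) \<bullet> e\<bar> \<le> Rt * (L2 * (norm d)\<^sup>2)" .
      have "\<bar>(l - lb) \<bullet> (g z + s)\<bar> \<le> norm (l - lb) * (C * mu l s)"
        by (rule abs_inner_le_mult [OF ok(2)])
      also have "\<dots> \<le> Rt * (C * mu l s)"
        using l_lb C mu_pos [OF el(2)] by (intro mult_right_mono) auto
      finally show "\<bar>(l - lb) \<bullet> (g z + s)\<bar> \<le> Rt * (C * mu l s)" .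
      show "g zs \<bullet> l \<le> 0"
        unfolding inner_vec_def using kkt(2) ok(3)
        by (intro sum_nonpos) (simp add: mult_nonpos_nonneg less_imp_le)
      show "norm d \<le> 1" using el(5) by (simp add: d_def dist_norm)
      show "0 \<le> mu l s" using mu_pos [OF el(2)] by simp
    qed simp
    moreover have "\<theta> * s $ i \<le> s \<bullet> lb" if "i \<in> B" for i
    proof -
      have "\<theta> * s $ i \<le> s $ i * lb $ i"
        using mult_right_mono [OF \<theta>(2) [OF that], of "s $ i"] ok(4) [of i] by (simp add: mult.commute)
      also have "\<dots> \<le> s \<bullet> lb"
        unfolding inner_vec_def inner_real_def using ok(4) kkt(3)
        by (intro member_le_sum) (auto simp: less_imp_le)
      finally show ?thesis .
    qed
    ultimately have "\<theta> * s $ i \<le> K * (mu l s + (norm d)\<^sup>2)" if "i \<in> B" for i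
      using that order_trans by blast
    then show ?case using \<theta>(1) by (simp add: p d_def field_simps)
  qed
  then show ?thesis using K \<theta>(1) by (intro exI [of _ "K / \<theta>"]) auto
qed

text \<open>The slack bound controls the part of \<open>z - z\<^sup>*\<close> outside the kernel of \<open>A\<^sup>T\<close> up to a quadratic term; the
  kernel part is controlled by testing the dual residual with it, as the multiplier term then
  only sees the inactive constraints.\<close>

lemma eventually_primal_distance:
  "\<exists>K>0. \<forall>\<^sub>F (z, l, s) in F. norm (z - zs) \<le> K * mu l s"
proof -
  obtain lb where lb: "lb \<in> multipliers \<phi> g zs"
    using mult by blast
  have kkt: "lagr_z \<phi> g zs lb = 0"
    using lb by (auto simp: multipliers_def kkt_def)
  obtain R where R: "\<forall>\<^sub>F (z, l, s) in F. norm l \<le> R"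
    using eventually_multiplier_bounded by blast
  obtain L2 where L2: "0 \<le> L2"
      "\<forall>\<^sub>F z in nhds zs. norm (g z - g zs - transpose (gradmat g zs) *v (z - zs)) \<le> L2 * (norm (z - zs))\<^sup>2"
    using constraint_quadratic_remainder_at [OF \<phi> g] by blast
  obtain K5 where K5: "0 < K5" "\<forall>\<^sub>F (z, l, s) in F. \<forall>i\<in>-B. l $ i \<le> K5 * mu l s"
    using eventually_multiplier_inactive by blast
  obtain K7 where K7: "0 < K7" "\<forall>\<^sub>F (z, l, s) in F. \<forall>i\<in>B. s $ i \<le> K7 * (mu l s + (norm (z - zs))\<^sup>2)"
    using eventually_slack_active by blast
  obtain \<alpha> where \<alpha>: "0 < \<alpha>" "\<forall>\<^sub>F (z, l, s) in F. \<forall>w. transpose A *v w = 0 \<longrightarrow>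
     \<alpha> * (norm w)\<^sup>2 \<le> w \<bullet> (lagr_zz \<phi> g zs l *v w) \<and> \<alpha> * (norm w)\<^sup>2 \<le> w \<bullet> (lagr_zz \<phi> g z l *v w)"
    using eventually_hessian_pos by blast
  obtain \<kappa> where \<kappa>: "0 < \<kappa>"
      "\<And>x. \<exists>v. transpose A *v v = 0 \<and> norm (x - v) \<le> \<kappa> * norm (transpose A *v x)"
    using matrix_dist_kernel_le [of "transpose A"] by blast
  define h where "h = norm (hess \<phi> zs) + (\<Sum>i\<in>UNIV. norm (hess (\<lambda>z. g z $ i) zs)) * \<bar>R\<bar>"
  define K8 where "K8 = C + CARD('m) * K7 + L2"
  define K9 where "K9 = C + norm (gradmat g zs) * (CARD('m) * K5)"
  define K10 where "K10 = (1 + h / \<alpha>) * (\<kappa> * K8)"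
  \<comment> \<open>The factor 2 absorbs |z - zs| / 2: one quarter is the linearization error,
    allowed up to \<alpha> / 4, and one quarter the quadratic slack term once |z - zs| is below 1 /
    (4 * K10).\<close>
  define K where "K = 2 * (K10 + K9 / \<alpha>)"
  have h: "0 \<le> h" by (simp add: h_def sum_nonneg)
  have K8: "0 < K8" using C K7(1) L2(1) by (simp add: K8_def add_pos_nonneg)
  have K9: "0 < K9" using C K5(1) by (simp add: K9_def add_pos_nonneg)
  have K10: "0 < K10" using h \<alpha>(1) \<kappa>(1) K8 by (simp add: K10_def add_pos_nonneg)
  have K: "0 < K" using K10 K9 \<alpha>(1) by (simp add: K_def add_pos_pos)
  have arith: "n \<le> K * m"
    if "n \<le> a + w" "a \<le> \<kappa> * (K8 * (m + n\<^sup>2))" "\<alpha> * w \<le> K9 * m + \<alpha> / 4 * n + h * a"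
      "n \<le> 1 / (4 * K10)" "0 \<le> n" for a w n m :: real
  proof -
    have "w \<le> K9 / \<alpha> * m + n / 4 + h / \<alpha> * a"
      using that(3) \<alpha>(1) by (simp add: field_simps)
    then have "n \<le> (1 + h / \<alpha>) * a + K9 / \<alpha> * m + n / 4"
      using that(1) by (simp add: algebra_simps)
    moreover have "(1 + h / \<alpha>) * a \<le> (1 + h / \<alpha>) * (\<kappa> * (K8 * (m + n\<^sup>2)))"
      using that(2) h \<alpha>(1) by (intro mult_left_mono) auto
    moreover have "\<dots> = K10 * m + (K10 * n) * n"
      by (simp add: K10_def algebra_simps power2_eq_square)
    moreover have "(K10 * n) * n \<le> (1 / 4) * n"
      using that(4,5) K10 by (intro mult_right_mono) (auto simp: field_simps)
    ultimately show ?thesis by (simp add: K_def algebra_simps)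
  qed
  have "0 < \<alpha> / 4" "0 < 1 / (4 * K10)" using \<alpha>(1) K10 by simp_all
  note lin = eventually_nhds_iterates [OF lagr_z_linearization [OF \<phi> g this(1), where R = R]]
    and near = eventually_near [OF this(2)]
  from R eventually_iterate_ok eventually_nhds_iterates [OF L2(2)] K5(2) K7(2) \<alpha>(2) lin near
  have "\<forall>\<^sub>F (z, l, s) in F. norm (z - zs) \<le> K * mu l s"
  proof eventually_elim
    case (elim p)
    obtain z l s where p: "p = (z, l, s)" by (cases p)
    note el = elim [unfolded p prod.case]
    have ok: "norm (lagr_z \<phi> g z l) \<le> C * mu l s" "norm (g z + s) \<le> C * mu l s"
      "\<And>i. 0 < l $ i" "\<And>i. 0 < s $ i"
      using el(2) by (auto simp: iterate_ok_def)
    have m: "0 < mu l s" using mu_pos [OF el(2)] .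
    have lagr: "lagr_z \<phi> g zs l = gradmat g zs *v (l - lb)"
      using kkt by (simp add: lagr_z_eq [OF \<phi> g] matrix_vector_mult_diff_distrib eq_neg_iff_add_eq_0 [symmetric])
    define d where "d = z - zs"
    define e where "e = g z - g zs - transpose (gradmat g zs) *v d"
    \<comment> \<open>On \<open>B\<close>, where g zs vanishes, A^T d is the primal residual minus
      the slack minus the remainder e.\<close>
    have At: "norm (transpose A *v d) \<le> K8 * (mu l s + (norm d)\<^sup>2)"
    proof -
      have "transpose A *v d = subvec B (g z + s) - subvec B s - subvec B e"
        unfolding transpose_submat_mult_vec e_def
        by (simp add: subvec_def vec_eq_iff active_def)
      then have "norm (transpose A *v d) \<le> norm (subvec B (g z + s)) + norm (subvec B s) + norm (subvec B e)"
        using norm_triangle_ineq4 [of "subvec B (g z + s) - subvec B s" "subvec B e"]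
          norm_triangle_ineq4 [of "subvec B (g z + s)" "subvec B s"] by simp
      also have "\<dots> \<le> C * mu l s + CARD('m) * (K7 * (mu l s + (norm d)\<^sup>2)) + L2 * (norm d)\<^sup>2"
      proof (intro add_mono)
        show "norm (subvec B (g z + s)) \<le> C * mu l s" using norm_subvec_le ok(2) by (rule order_trans)
        show "norm (subvec B s) \<le> CARD('m) * (K7 * (mu l s + (norm d)\<^sup>2))"
          using el(5) ok(4) K7(1) m by (intro norm_subvec_le_bound) (auto simp: d_def abs_of_pos less_imp_le)
        show "norm (subvec B e) \<le> L2 * (norm d)\<^sup>2"
          using norm_subvec_le [of B e] el(3) by (simp add: e_def d_def)
      qed
      also have "\<dots> \<le> C * (mu l s + (norm d)\<^sup>2) + CARD('m) * (K7 * (mu l s + (norm d)\<^sup>2)) + L2 * (mu l s + (norm d)\<^sup>2)"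
        using C L2(1) K7(1) m by (intro add_mono mult_left_mono) auto
      finally show ?thesis by (simp add: K8_def distrib_right mult.assoc)
    qed
    obtain w where w: "transpose A *v w = 0" "norm (d - w) \<le> \<kappa> * norm (transpose A *v d)"
      using \<kappa>(2) by blast
    have "norm d \<le> K * mu l s"
    proof (rule arith)
      show "norm d \<le> norm (d - w) + norm w" using norm_triangle_ineq [of "d - w" w] by simp
      have "\<kappa> * norm (transpose A *v d) \<le> \<kappa> * (K8 * (mu l s + (norm d)\<^sup>2))"
        using At \<kappa>(1) by (intro mult_left_mono) auto
      with w(2) show "norm (d - w) \<le> \<kappa> * (K8 * (mu l s + (norm d)\<^sup>2))" by (rule order_trans)
      show "norm d \<le> 1 / (4 * K10)" using el(8) by (simp add: d_def dist_norm)
      define H where "H = lagr_zz \<phi> g zs l"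
      define e' where "e' = lagr_z \<phi> g z l - lagr_z \<phi> g zs l - H *v d"
      have e': "norm e' \<le> \<alpha> / 4 * norm d"
        using el(1,7) unfolding e'_def d_def H_def by blast
      have Hn: "norm H \<le> h"
        unfolding H_def h_def using el(1) by (intro norm_lagr_zz_le [OF \<phi> g]) auto
      have "w \<bullet> lagr_z \<phi> g zs l = (transpose (gradmat g zs) *v w) \<bullet> (l - lb)"
        using inner_transpose_mult [of "l - lb" "gradmat g zs" w] by (simp add: lagr inner_commute)
      \<comment> \<open>Active entries vanish by the choice of w; on inactive ones lb is zero by
        complementarity.\<close>
      also have "\<dots> = (transpose (gradmat g zs) *v w) \<bullet> subvec (- B) l"
      proof -
        have "(transpose (gradmat g zs) *v w) $ i = 0" if "i \<in> B" for i
        proof -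
          have "subvec B (transpose (gradmat g zs) *v w) $ i = 0"
            using w(1) unfolding transpose_submat_mult_vec by simp
          then show ?thesis using that by (simp add: subvec_def)
        qed
        then show ?thesis
          unfolding inner_vec_def using multiplier_zero_inactive [OF lb]
          by (intro sum.cong refl) (auto simp: subvec_def)
      qed
      also have "\<bar>\<dots>\<bar> \<le> norm (transpose (gradmat g zs) *v w) * norm (subvec (- B) l)"
        by (rule Cauchy_Schwarz_ineq2)
      also have "\<dots> \<le> (norm (gradmat g zs) * norm w) * (CARD('m) * (K5 * mu l s))"
      proof (rule mult_mono)
        show "norm (transpose (gradmat g zs) *v w) \<le> norm (gradmat g zs) * norm w"
          by (rule norm_matrix_vector_mono) (simp add: norm_transpose)
        show "norm (subvec (- B) l) \<le> CARD('m) * (K5 * mu l s)"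
          using el(4) ok(3) K5(1) m by (intro norm_subvec_le_bound) (auto simp: abs_of_pos)
      qed auto
      finally have 1: "\<bar>w \<bullet> lagr_z \<phi> g zs l\<bar> \<le> norm w * (norm (gradmat g zs) * (CARD('m) * K5) * mu l s)"
        by (simp add: ac_simps)
      have arith2: "x \<le> n * (p + q + r + t)"
        if "x = a - b - c - d" "\<bar>a\<bar> \<le> n * p" "\<bar>b\<bar> \<le> n * q" "\<bar>c\<bar> \<le> n * r" "\<bar>d\<bar> \<le> n * t" for x n p q r t a b c d :: real
        using that by (simp add: distrib_left)
      have "w \<bullet> (H *v w) \<le> norm w * (C * mu l s + norm (gradmat g zs) * (CARD('m) * K5) * mu l s
          + \<alpha> / 4 * norm d + h * norm (d - w))"
      proof (rule arith2)
        show "w \<bullet> (H *v w) = w \<bullet> lagr_z \<phi> g z l - w \<bullet> lagr_z \<phi> g zs l - w \<bullet> e' - w \<bullet> (H *v (d - w))"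
          by (simp add: e'_def inner_diff_right matrix_vector_mult_diff_distrib)
        show "\<bar>w \<bullet> lagr_z \<phi> g z l\<bar> \<le> norm w * (C * mu l s)" by (rule abs_inner_le_mult [OF ok(1)])
        show "\<bar>w \<bullet> e'\<bar> \<le> norm w * (\<alpha> / 4 * norm d)" by (rule abs_inner_le_mult [OF e'])
        show "\<bar>w \<bullet> (H *v (d - w))\<bar> \<le> norm w * (h * norm (d - w))"
          by (intro abs_inner_le_mult norm_matrix_vector_mono Hn)
        show "\<bar>w \<bullet> lagr_z \<phi> g zs l\<bar> \<le> norm w * (norm (gradmat g zs) * (CARD('m) * K5) * mu l s)" by (rule 1)
      qed
      also have "\<dots> = norm w * (K9 * mu l s + \<alpha> / 4 * norm d + h * norm (d - w))"
        by (simp add: K9_def distrib_right)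
      finally have "\<alpha> * (norm w)\<^sup>2 \<le> norm w * (K9 * mu l s + \<alpha> / 4 * norm d + h * norm (d - w))"
        using el(6) w(1) unfolding H_def by (meson order_trans)
      moreover have "0 \<le> K9 * mu l s + \<alpha> / 4 * norm d + h * norm (d - w)"
        using K9 m \<alpha>(1) h by (intro add_nonneg_nonneg mult_nonneg_nonneg) auto
      ultimately show "\<alpha> * norm w \<le> K9 * mu l s + \<alpha> / 4 * norm d + h * norm (d - w)"
        by (cases "norm w = 0") (auto simp: power2_eq_square)
    qed simp
    then show ?case by (simp add: p d_def)
  qed
  then show ?thesis using K by blast
qed


text \<open>With z - zs = O(\<mu>) the slack bound becomes s_i = O(\<mu>), and l_i s_i \<ge>
  \<gamma> \<mu> then keeps l_i away from zero. This bounds s_i / l_i above; the lower bound is l_i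
  s_i divided by the bounded l_i^2.\<close>

lemma eventually_duality_active:
  "\<exists>M>0. \<forall>\<^sub>F (z, l, s) in F. \<forall>i\<in>B. s $ i \<le> M * mu l s \<and>
     mu l s \<le> M * (s $ i / l $ i) \<and> s $ i / l $ i \<le> M * mu l s \<and> 1 / l $ i \<le> M"
proof -
  obtain K7 where K7: "0 < K7" "\<forall>\<^sub>F (z, l, s) in F. \<forall>i\<in>B. s $ i \<le> K7 * (mu l s + (norm (z - zs))\<^sup>2)"
    using eventually_slack_active by blast
  obtain K8 where K8: "0 < K8" "\<forall>\<^sub>F (z, l, s) in F. norm (z - zs) \<le> K8 * mu l s"
    using eventually_primal_distance by blast
  obtain R where R: "\<forall>\<^sub>F (z, l, s) in F. norm l \<le> R"
    using eventually_multiplier_bounded by blast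
  define Ka where "Ka = K7 * (1 + K8)"
  have Ka: "0 < Ka" using K7(1) K8(1) by (simp add: Ka_def add_pos_pos)
  define M where "M = Ka + R\<^sup>2 / \<gamma> + Ka * (Ka / \<gamma>) + Ka / \<gamma>"
  have pos: "0 \<le> R\<^sup>2 / \<gamma>" "0 < Ka * (Ka / \<gamma>)" "0 < Ka / \<gamma>" using Ka \<gamma> by simp_all
  then have M: "0 < M" "Ka \<le> M" "R\<^sup>2 / \<gamma> \<le> M" "Ka * (Ka / \<gamma>) \<le> M" "Ka / \<gamma> \<le> M"
    using Ka by (simp_all add: M_def)
  from K7(2) K8(2) R eventually_iterate_ok eventually_near [of 1, simplified]
  have "\<forall>\<^sub>F (z, l, s) in F. \<forall>i\<in>B. s $ i \<le> M * mu l s \<and>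
     mu l s \<le> M * (s $ i / l $ i) \<and> s $ i / l $ i \<le> M * mu l s \<and> 1 / l $ i \<le> M"
  proof eventually_elim
    case (elim p)
    obtain z l s where p: "p = (z, l, s)" by (cases p)
    note el = elim [unfolded p prod.case]
    define m where "m = mu l s"
    have m: "0 < m" using mu_pos [OF el(4)] by (simp add: m_def)
    have "s $ i \<le> M * m \<and> m \<le> M * (s $ i / l $ i) \<and> s $ i / l $ i \<le> M * m \<and> 1 / l $ i \<le> M"
      if "i \<in> B" for i
    proof -
      have li: "0 < l $ i" "0 < s $ i" "\<gamma> * m \<le> l $ i * s $ i"
        using el(4) by (auto simp: iterate_ok_def m_def)
      have "norm (z - zs) \<le> 1" using el(5) by (simp add: dist_norm)
      then have "(norm (z - zs))\<^sup>2 \<le> norm (z - zs)"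
        by (simp add: power2_eq_square mult_left_le)
      then have "m + (norm (z - zs))\<^sup>2 \<le> (1 + K8) * m"
        using el(2) by (simp add: distrib_right m_def)
      then have "K7 * (m + (norm (z - zs))\<^sup>2) \<le> K7 * ((1 + K8) * m)"
        using K7(1) by (intro mult_left_mono) auto
      then have si: "s $ i \<le> Ka * m"
        using el(1) that unfolding Ka_def m_def mult.assoc by (meson order_trans)
      have lR: "l $ i \<le> R"
        using component_le_norm_cart [of l i] el(3) by linarith
      have "\<gamma> * m \<le> l $ i * (Ka * m)"
        using li(3) mult_left_mono [OF si less_imp_le [OF li(1)]] by linarith
      then have "\<gamma> \<le> l $ i * Ka" using m by (simp add: mult.assoc [symmetric])
      then have inv: "1 / l $ i \<le> Ka / \<gamma>" using li(1) \<gamma> by (simp add: field_simps)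
      have "s $ i * (1 / l $ i) \<le> (Ka * m) * (Ka / \<gamma>)"
        using si inv li Ka m by (intro mult_mono) auto
      also have "\<dots> \<le> M * m"
        using mult_right_mono [OF M(4), of m] m by (simp add: ac_simps)
      finally have up: "s $ i / l $ i \<le> M * m" by simp
      have "\<gamma> * m \<le> (l $ i)\<^sup>2 * (s $ i / l $ i)"
        using li by (simp add: power2_eq_square)
      also have "\<dots> \<le> R\<^sup>2 * (s $ i / l $ i)"
        using lR li by (intro mult_right_mono power_mono) auto
      finally have "m \<le> R\<^sup>2 / \<gamma> * (s $ i / l $ i)"
        using \<gamma> li by (simp add: field_simps)
      also have "\<dots> \<le> M * (s $ i / l $ i)"
        using M(3) li by (intro mult_right_mono) auto
      finally have "m \<le> M * (s $ i / l $ i)" .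
      moreover have "s $ i \<le> M * m" using si mult_right_mono [OF M(2), of m] m by linarith
      ultimately show ?thesis using up inv M(5) by (meson order_trans)
    qed
    then show ?case by (simp add: p m_def)
  qed
  then show ?thesis using M(1) by blast
qed

text \<open>l_i = O(\<mu>) against a slack bounded below gives the first half. For the second, s is
  bounded, so l_i s_i \<ge> \<gamma> \<mu> prevents l_i from being smaller than order \<mu>; it will
  bound t_i / l_i in the right-hand side.\<close>

lemma eventually_duality_inactive:
  "\<exists>M>0. \<forall>\<^sub>F (z, l, s) in F. \<forall>i\<in>-B. 1 \<le> M * mu l s * (s $ i / l $ i) \<and> mu l s * (1 / l $ i) \<le> M"
proof -
  obtain \<sigma> where \<sigma>: "0 < \<sigma>" "\<forall>\<^sub>F (z, l, s) in F. \<forall>i\<in>-B. \<sigma> \<le> s $ i"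
    using eventually_slack_inactive by blast
  obtain K5 where K5: "0 < K5" "\<forall>\<^sub>F (z, l, s) in F. \<forall>i\<in>-B. l $ i \<le> K5 * mu l s"
    using eventually_multiplier_inactive by blast
  define S where "S = norm (g zs) + 1"
  define M where "M = K5 / \<sigma> + S / \<gamma>"
  have S: "0 < S" by (simp add: S_def add_nonneg_pos)
  then have M: "0 < M" "K5 / \<sigma> \<le> M" "S / \<gamma> \<le> M"
    using K5(1) \<sigma>(1) \<gamma> by (simp_all add: M_def add_pos_pos)
  from \<sigma>(2) K5(2) eventually_slack_bounded eventually_iterate_ok
  have "\<forall>\<^sub>F (z, l, s) in F. \<forall>i\<in>-B. 1 \<le> M * mu l s * (s $ i / l $ i) \<and> mu l s * (1 / l $ i) \<le> M"
  proof eventually_elim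
    case (elim p)
    obtain z l s where p: "p = (z, l, s)" by (cases p)
    note el = elim [unfolded p prod.case]
    define m where "m = mu l s"
    have m: "0 < m" using mu_pos [OF el(4)] by (simp add: m_def)
    have "1 \<le> M * m * (s $ i / l $ i) \<and> m * (1 / l $ i) \<le> M" if "i \<in> - B" for i
    proof -
      have li: "0 < l $ i" "0 < s $ i" "\<gamma> * m \<le> l $ i * s $ i"
        using el(4) by (auto simp: iterate_ok_def m_def)
      have si: "\<sigma> \<le> s $ i" and lK: "l $ i \<le> K5 * m" using el(1,2) that by (auto simp: m_def)
      have "l $ i * \<sigma> \<le> (K5 * m) * s $ i"
        using si lK li \<sigma>(1) K5(1) m by (intro mult_mono) auto
      then have "1 \<le> K5 / \<sigma> * (m * (s $ i / l $ i))"
        using li \<sigma>(1) by (simp add: field_simps)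
      also have "\<dots> \<le> M * (m * (s $ i / l $ i))"
        using M(2) li m by (intro mult_right_mono) auto
      finally have 1: "1 \<le> M * m * (s $ i / l $ i)" by (simp add: mult.assoc)
      have sS: "s $ i \<le> S"
        using component_le_norm_cart [of s i] el(3) unfolding S_def by linarith
      have "\<gamma> * m \<le> l $ i * S"
        using li(3) mult_left_mono [OF sS less_imp_le [OF li(1)]] by linarith
      then have "m * (1 / l $ i) \<le> S / \<gamma>" using li(1) \<gamma> by (simp add: field_simps)
      then show ?thesis using 1 M(3) by linarith
    qed
    then show ?case by (simp add: p m_def)
  qed
  then show ?thesis using M(1) by blast
qed

text \<open>The free lower bound K lets the same M dominate the kernel distance constants of
  \<open>A\<close> and its transpose, as \<open>saddle_estimate\<close> works with a single
  constant.\<close>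

lemma eventually_step_bounds: "\<exists>M\<ge>1. K \<le> M \<and> (\<forall>\<^sub>F (z, l, s) in F. step_bounds \<phi> g zs M z l s)"
proof -
  obtain Ma where Ma: "0 < Ma" "\<forall>\<^sub>F (z, l, s) in F. \<forall>i\<in>B. s $ i \<le> Ma * mu l s \<and>
     mu l s \<le> Ma * (s $ i / l $ i) \<and> s $ i / l $ i \<le> Ma * mu l s \<and> 1 / l $ i \<le> Ma"
    using eventually_duality_active by blast
  obtain Mi where Mi: "0 < Mi"
      "\<forall>\<^sub>F (z, l, s) in F. \<forall>i\<in>-B. 1 \<le> Mi * mu l s * (s $ i / l $ i) \<and> mu l s * (1 / l $ i) \<le> Mi"
    using eventually_duality_inactive by blast
  obtain K8 where K8: "0 < K8" "\<forall>\<^sub>F (z, l, s) in F. norm (z - zs) \<le> K8 * mu l s"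
    using eventually_primal_distance by blast
  obtain R where R: "\<forall>\<^sub>F (z, l, s) in F. norm l \<le> R"
    using eventually_multiplier_bounded by blast
  obtain L3 where L3: "0 \<le> L3" "\<forall>\<^sub>F z in nhds zs. norm (gradmat g z - gradmat g zs) \<le> L3 * norm (z - zs)"
    using gradmat_lipschitz_at [OF \<phi> g] by blast
  obtain \<alpha> where \<alpha>: "0 < \<alpha>" "\<forall>\<^sub>F (z, l, s) in F. \<forall>w. transpose A *v w = 0 \<longrightarrow>
     \<alpha> * (norm w)\<^sup>2 \<le> w \<bullet> (lagr_zz \<phi> g zs l *v w) \<and> \<alpha> * (norm w)\<^sup>2 \<le> w \<bullet> (lagr_zz \<phi> g z l *v w)"
    using eventually_hessian_pos by blast
  define h where "h = norm (hess \<phi> zs) + (\<Sum>i\<in>UNIV. norm (hess (\<lambda>z. g z $ i) zs)) * \<bar>R\<bar>"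
  have h: "0 \<le> h" by (simp add: h_def sum_nonneg)
  define M where "M = 1 + Ma + Mi + L3 * K8 + (norm (gradmat g zs) + L3) + (h + 1) + (norm (g zs) + 1)
     + (C + CARD('m) * Ma) + 1 / \<alpha> + \<bar>K\<bar>"
  have "0 \<le> L3 * K8" "0 < 1 / \<alpha>" "0 \<le> CARD('m) * Ma" using L3 K8 \<alpha>(1) Ma(1) by simp_all
  then have M: "1 \<le> M" "Ma \<le> M" "Mi \<le> M" "L3 * K8 \<le> M" "norm (gradmat g zs) + L3 \<le> M" "h + 1 \<le> M"
      "norm (g zs) + 1 \<le> M" "C + CARD('m) * Ma \<le> M" "1 / \<alpha> \<le> M" "K \<le> M"
    using Ma(1) Mi(1) L3(1) h C norm_ge_zero [of "g zs"] norm_ge_zero [of "gradmat g zs"]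
    unfolding M_def by linarith+
  note hc = eventually_nhds_iterates [OF lagr_zz_continuous [OF \<phi> g, of 1, simplified, where R = R]]
    and gc = eventually_nhds_iterates [OF constraint_continuous [of 1, simplified]]
  from Ma(2) Mi(2) K8(2) R eventually_nhds_iterates [OF L3(2)] \<alpha>(2) hc gc eventually_iterate_ok
    eventually_near [of 1, simplified]
  have "\<forall>\<^sub>F (z, l, s) in F. step_bounds \<phi> g zs M z l s"
  proof eventually_elim
    case (elim p)
    obtain z l s where p: "p = (z, l, s)" by (cases p)
    note el = elim [unfolded p prod.case]
    have m: "0 < mu l s" using mu_pos [OF el(9)] .
    have ok: "norm (g z + s) \<le> C * mu l s" "\<And>i. 0 < l $ i" "\<And>i. 0 < s $ i"
      using el(9) by (auto simp: iterate_ok_def)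
    have Mm: "x \<le> M * y" if "x \<le> K * y" "K \<le> M" "0 \<le> y" for x y K
      using that mult_right_mono order_trans by blast
    have "norm (gradmat g z - gradmat g zs) \<le> L3 * (K8 * mu l s)"
      using el(3,5) mult_left_mono [OF el(3) L3(1)] by linarith
    then have grad_near: "norm (submat UNIV B (gradmat g z) - A) \<le> M * mu l s"
      using norm_submat_le [of UNIV B "gradmat g z - gradmat g zs"] M(4) m
      by (intro Mm [of _ "L3 * K8"]) (auto simp: submat_diff mult.assoc)
    have "L3 * norm (z - zs) \<le> L3 * 1"
      using el(10) L3(1) by (intro mult_left_mono) (auto simp: dist_norm)
    then have grad_bd: "norm (gradmat g z) \<le> M"
      using el(5) norm_triangle_sub [of "gradmat g z" "gradmat g zs"] M(5) by linarith
    have "norm (lagr_zz \<phi> g zs l) \<le> h"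
      unfolding h_def using el(4) by (intro norm_lagr_zz_le [OF \<phi> g]) auto
    moreover have "norm (lagr_zz \<phi> g z l - lagr_zz \<phi> g zs l) \<le> 1" using el(4,7) by blast
    ultimately have hess_bd: "norm (lagr_zz \<phi> g z l) \<le> M"
      using norm_triangle_sub [of "lagr_zz \<phi> g z l" "lagr_zz \<phi> g zs l"] M(6) by linarith
    have g_bd: "norm (g z) \<le> M"
      using norm_triangle_sub [of "g z" "g zs"] el(8) M(7) by linarith
    have "norm (subvec B (g z + s)) \<le> C * mu l s" using norm_subvec_le ok(1) by (rule order_trans)
    moreover have "norm (subvec B s) \<le> CARD('m) * (Ma * mu l s)"
      using el(1) ok(3) Ma(1) m by (intro norm_subvec_le_bound) (auto simp: abs_of_pos)
    moreover have "subvec B (g z) = subvec B (g z + s) - subvec B s"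
      by (simp add: subvec_diff [symmetric])
    ultimately have "norm (subvec B (g z)) \<le> C * mu l s + CARD('m) * (Ma * mu l s)"
      using norm_triangle_ineq4 [of "subvec B (g z + s)" "subvec B s"] by simp
    then have gB: "norm (subvec B (g z)) \<le> M * mu l s"
      using M(8) m by (intro Mm [of _ "C + CARD('m) * Ma"]) (auto simp: algebra_simps)
    have pd: "(norm w)\<^sup>2 \<le> M * (w \<bullet> (lagr_zz \<phi> g z l *v w))" if "transpose A *v w = 0" for w
    proof -
      have *: "\<alpha> * (norm w)\<^sup>2 \<le> w \<bullet> (lagr_zz \<phi> g z l *v w)" using el(6) that by blast
      moreover have "0 \<le> \<alpha> * (norm w)\<^sup>2" using \<alpha>(1) by simp
      ultimately have "0 \<le> w \<bullet> (lagr_zz \<phi> g z l *v w)" by (rule order_trans [rotated])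
      moreover have "(norm w)\<^sup>2 \<le> 1 / \<alpha> * (w \<bullet> (lagr_zz \<phi> g z l *v w))"
        using mult_left_mono [OF *, of "1 / \<alpha>"] \<alpha>(1) by simp
      ultimately show ?thesis using M(9) Mm by blast
    qed
    have act: "mu l s \<le> M * (s $ i / l $ i) \<and> s $ i / l $ i \<le> M * mu l s \<and> 1 / l $ i \<le> M" if "i \<in> B" for i
    proof -
      have "0 \<le> s $ i / l $ i" using ok(2,3) by (simp add: less_imp_le)
      then show ?thesis using el(1) that M(2) m Mm less_imp_le order_trans by meson
    qed
    have inact: "1 \<le> M * mu l s * (s $ i / l $ i) \<and> mu l s * (1 / l $ i) \<le> M" if "i \<in> - B" for i
    proof -
      have "0 \<le> mu l s * (s $ i / l $ i)" using ok(2,3) m by (simp add: less_imp_le)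
      then show ?thesis using el(2) that M(3) Mm order_trans unfolding mult.assoc by meson
    qed
    show ?case
      unfolding p prod.case step_bounds_def Let_def
      using grad_near grad_bd hess_bd g_bd gB pd act inact by blast
  qed
  then show ?thesis using M(1,10) by blast
qed

end

section \<open>Singular vectors and step equations\<close>

text \<open>Bessel's inequality: p is the orthogonal projection of x onto the span of the first k
  columns, and |x - p|^2 is nonnegative.\<close>

lemma norm_tmult_le:
  fixes Q :: "nat \<Rightarrow> 'a::real_inner"
  assumes "orthonormal_cols k Q"
  shows "norm_tmult k Q x \<le> norm x"
proof -
  define p where "p = (\<Sum>i<k. (Q i \<bullet> x) *\<^sub>R Q i)"
  have Qp: "Q j \<bullet> p = Q j \<bullet> x" if "j < k" for j
  proof -
    have "Q j \<bullet> p = (\<Sum>i<k. (Q i \<bullet> x) * (if i = j then 1 else 0))"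
      unfolding p_def inner_sum_right using assms that
      by (intro sum.cong) (auto simp: orthonormal_cols_def)
    also have "\<dots> = Q j \<bullet> x" using that by (simp add: if_distrib cong: if_cong)
    finally show ?thesis .
  qed
  have xp: "p \<bullet> y = (\<Sum>i<k. (Q i \<bullet> x) * (Q i \<bullet> y))" for y
    by (simp add: p_def inner_sum_left)
  have pp: "p \<bullet> p = p \<bullet> x"
    unfolding xp by (rule sum.cong) (auto simp: Qp)
  have "0 \<le> (x - p) \<bullet> (x - p)" by simp
  then have "p \<bullet> x \<le> x \<bullet> x"
    by (simp add: inner_diff_left inner_diff_right pp inner_commute)
  then have "(\<Sum>i<k. (Q i \<bullet> x)\<^sup>2) \<le> (norm x)\<^sup>2"
    by (simp add: xp [of x] power2_eq_square power2_norm_eq_inner [unfolded power2_eq_square])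
  then show ?thesis
    unfolding norm_tmult_def L2_set_def by (simp add: real_le_lsqrt sum_nonneg)
qed

lemma svd_orthonormal_cols:
  fixes A :: "real^'m^'n"
  assumes "svd B A r Uh Vh sg U V"
  shows "orthonormal_cols r Uh" "orthonormal_cols r U" "orthonormal_cols (card B - r) V"
proof -
  have hat: "orthonormal_cols CARD('n) (append_cols r Uh Vh)" "r \<le> CARD('n)"
    and uv: "orthonormal_cols (card B) (append_cols r U V)" "r \<le> card B"
    using assms by (auto simp: svd_def)
  have first: "orthonormal_cols r P" if "orthonormal_cols k (append_cols r P Q)" "r \<le> k"
    for k and P Q :: "nat \<Rightarrow> 'v::real_inner"
    unfolding orthonormal_cols_def
  proof (intro allI impI)
    fix i j assume "i < r" "j < r"
    then show "P i \<bullet> P j = (if i = j then 1 else 0)"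
      using that unfolding orthonormal_cols_def
      by (metis append_cols_def order_less_le_trans)
  qed
  show "orthonormal_cols r Uh" "orthonormal_cols r U"
    using first hat uv by blast+
  show "orthonormal_cols (card B - r) V"
    unfolding orthonormal_cols_def
  proof (intro allI impI)
    fix i j assume "i < card B - r" "j < card B - r"
    then have "r + i < card B" "r + j < card B" by auto
    then have "append_cols r U V (r + i) \<bullet> append_cols r U V (r + j) = (if r + i = r + j then 1 else 0)"
      using uv(1) by (auto simp: orthonormal_cols_def)
    then show "V i \<bullet> V j = (if i = j then 1 else 0)" by (simp add: append_cols_def)
  qed
qed

text \<open>A v is the combination of the orthonormal \<open>Uh\<close> with coefficients sg k * (U
  k . v), and sg k is positive.\<close>

lemma svd_kernel:
  assumes svd: "svd B A r Uh Vh sg U V" and v: "A *v v = 0" and k: "k < r"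
  shows "U k \<bullet> v = 0"
proof -
  have A: "A $ i $ j = (\<Sum>k<r. Uh k $ i * sg k * U k $ j)" for i j
    using svd by (simp add: svd_def)
  have "A *v v = (\<Sum>k<r. (sg k * (U k \<bullet> v)) *\<^sub>R Uh k)"
  proof (rule vec_eq_iff [THEN iffD2], rule allI)
    fix i
    have "(A *v v) $ i = (\<Sum>j\<in>UNIV. \<Sum>k<r. Uh k $ i * sg k * U k $ j * v $ j)"
      by (simp add: matrix_vector_mult_def A sum_distrib_right)
    also have "\<dots> = (\<Sum>k<r. \<Sum>j\<in>UNIV. Uh k $ i * sg k * U k $ j * v $ j)"
      by (rule sum.swap)
    also have "\<dots> = (\<Sum>k<r. (sg k * (U k \<bullet> v)) *\<^sub>R Uh k) $ i"
      by (simp add: inner_vec_def sum_distrib_left sum_distrib_right ac_simps)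
    finally show "(A *v v) $ i = (\<Sum>k<r. (sg k * (U k \<bullet> v)) *\<^sub>R Uh k) $ i" .
  qed
  then have "0 = Uh k \<bullet> (\<Sum>k<r. (sg k * (U k \<bullet> v)) *\<^sub>R Uh k)" using v by simp
  also have "\<dots> = (\<Sum>i<r. (sg i * (U i \<bullet> v)) * (if i = k then 1 else 0))"
    unfolding inner_sum_right using svd_orthonormal_cols(1) [OF svd] k
    by (intro sum.cong) (auto simp: orthonormal_cols_def)
  also have "\<dots> = sg k * (U k \<bullet> v)" using k by (simp add: if_distrib cong: if_cong)
  finally have "sg k * (U k \<bullet> v) = 0" by simp
  moreover have "0 < sg k" using svd k by (simp add: svd_def)
  ultimately show ?thesis by simp
qed

text \<open>This links the kernel splitting, which mentions no singular vectors, to the U-part of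
  the conclusion: U^T annihilates ker A.\<close>

lemma norm_tmult_range_le:
  assumes "svd B A r Uh Vh sg U V" and "A *v v = 0"
  shows "norm_tmult r U x \<le> norm (x - v)"
proof -
  have "norm_tmult r U x = norm_tmult r U (x - v)"
    unfolding norm_tmult_def using svd_kernel [OF assms]
    by (intro L2_set_cong) (auto simp: inner_diff_right)
  then show ?thesis using norm_tmult_le [OF svd_orthonormal_cols(2) [OF assms(1)]] by metis
qed

section \<open>Reduction of both steps to the same saddle system\<close>

lemma diag_mult_vec: "diag v *v x = (\<chi> i. v $ i * x $ i)"
  by (simp add: vec_eq_iff matrix_vector_mult_def diag_def if_distrib if_distribR cong: if_cong)

lemma submat_diag_mult_vec: "submat I I (diag v) *v x = subvec I (\<chi> i. v $ i * x $ i)"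
proof -
  have "submat I I (diag v) = diag (subvec I v)"
    by (auto simp: vec_eq_iff submat_def diag_def subvec_def)
  then show ?thesis unfolding diag_mult_vec by (simp add: diag_mult_vec) (simp add: subvec_def vec_eq_iff)
qed

lemma matrix_inv_diag:
  fixes v :: "real^'m"
  assumes "\<And>i. v $ i \<noteq> 0"
  shows "matrix_inv (diag v) = diag (\<chi> i. 1 / v $ i)"
proof -
  have mult: "diag a ** diag b = diag (\<chi> i. a $ i * b $ i)" for a b :: "real^'m"
    unfolding matrix_eq by (simp add: matrix_vector_mul_assoc [symmetric] diag_mult_vec mult.assoc)
  have one: "diag (\<chi> i. (1::real)) = (mat 1 :: real^'m^'m)"
    unfolding matrix_eq by (simp add: diag_mult_vec)
  have right: "diag v ** diag (\<chi> i. 1 / v $ i) = mat 1" and left: "diag (\<chi> i. 1 / v $ i) ** diag v = mat 1"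
    using assms by (simp_all add: mult one [symmetric])
  \<comment> \<open>\<open>matrix_inv\<close> chooses some two-sided inverse; existence makes the
    choice an inverse, and the left inverse identifies it.\<close>
  then have "\<exists>X. diag v ** X = mat 1 \<and> X ** diag v = mat 1" by blast
  then have inv: "diag v ** matrix_inv (diag v) = mat 1"
    unfolding matrix_inv_def by (rule someI2_ex) blast
  have "matrix_inv (diag v) = (diag (\<chi> i. 1 / v $ i) ** diag v) ** matrix_inv (diag v)"
    by (simp add: left)
  also have "\<dots> = diag (\<chi> i. 1 / v $ i)"
    by (simp add: matrix_mul_assoc [symmetric] inv)
  finally show ?thesis .
qed

text \<open>The complementarity row is solved for ds by division by l_i and inserted into the second
  row. This produces the diagonal -s_i / l_i, and s itself cancels from the right-hand side.\<close>

lemma exact_step_saddle: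
  assumes step: "exact_step \<phi> g z l s t dz dl ds" and l: "\<And>i. 0 < l $ i"
  defines "rhs \<equiv> (\<chi> i. - g z $ i + t $ i / l $ i)"
  shows "lagr_zz \<phi> g z l *v dz + submat UNIV B (gradmat g z) *v subvec B dl
      + submat UNIV (- B) (gradmat g z) *v subvec (- B) dl = - lagr_z \<phi> g z l"
    and "transpose (submat UNIV I (gradmat g z)) *v dz - (\<chi> i. (s $ i / l $ i) * subvec I dl $ i)
      = subvec I rhs"
proof -
  have "submat UNIV B (gradmat g z) *v subvec B dl + submat UNIV (- B) (gradmat g z) *v subvec (- B) dl
     = gradmat g z *v (subvec B dl + subvec (- B) dl)"
    unfolding submat_mult_vec matrix_vector_right_distrib by (simp add: subvec_def cong: if_cong)
  then show "lagr_zz \<phi> g z l *v dz + submat UNIV B (gradmat g z) *v subvec B dl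
      + submat UNIV (- B) (gradmat g z) *v subvec (- B) dl = - lagr_z \<phi> g z l"
    using step by (simp add: exact_step_def subvec_add_compl add.assoc)
  have eq2: "(transpose (gradmat g z) *v dz) $ i + ds $ i = - (g z $ i + s $ i)" for i
    using step by (simp add: exact_step_def vec_eq_iff)
  have eq3: "s $ i * dl $ i + l $ i * ds $ i = - (s $ i * l $ i + t $ i)" for i
    using step by (simp add: exact_step_def vec_eq_iff diag_mult_vec matrix_vector_mul_assoc [symmetric])
  have "(transpose (gradmat g z) *v dz) $ i - (s $ i / l $ i) * dl $ i = rhs $ i" for i
  proof -
    have "ds $ i = - s $ i - t $ i / l $ i - (s $ i / l $ i) * dl $ i"
    proof -
      have "l $ i * ds $ i = - (l $ i * s $ i) - t $ i - s $ i * dl $ i"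
        using eq3 [of i] by (simp add: algebra_simps)
      then have "ds $ i = (- (l $ i * s $ i) - t $ i - s $ i * dl $ i) / l $ i"
        using l [of i] by (metis less_irrefl nonzero_mult_div_cancel_left)
      then show ?thesis using l [of i] by (simp add: diff_divide_distrib)
    qed
    with eq2 [of i] show ?thesis by (simp add: rhs_def)
  qed
  then show "transpose (submat UNIV I (gradmat g z)) *v dz - (\<chi> i. (s $ i / l $ i) * subvec I dl $ i)
      = subvec I rhs"
    unfolding transpose_submat_mult_vec by (simp add: vec_eq_iff subvec_def)
qed

text \<open>The perturbations are moved to the right, applied to the computed (w, y, q). Both steps
  then have the same matrix, so their difference can be treated by the saddle estimate.\<close>

lemma perturbed_step_saddle:
  fixes l s :: "real^'m"
  assumes step: "perturbed_step \<phi> g B z l s t E11 E12 E13 E21 E22 E23 E31 E32 E33 f1 f2 f3 w y q"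
    and l: "\<And>i. 0 < l $ i"
  defines "rhs \<equiv> (\<chi> i. - g z $ i + t $ i / l $ i)"
  shows "lagr_zz \<phi> g z l *v w + submat UNIV B (gradmat g z) *v y + submat UNIV (- B) (gradmat g z) *v q
      = - lagr_z \<phi> g z l + f1 - (E11 *v w + E12 *v y + E13 *v q)"
    and "transpose (submat UNIV B (gradmat g z)) *v w - (\<chi> i. (s $ i / l $ i) * y $ i)
      = subvec B rhs + f2 - (E21 *v w + E22 *v y + E23 *v q)"
    and "transpose (submat UNIV (- B) (gradmat g z)) *v w - (\<chi> i. (s $ i / l $ i) * q $ i)
      = subvec (- B) rhs + f3 - (E31 *v w + E32 *v y + E33 *v q)"
    and "subvec B y = y" and "subvec (- B) q = q"
proof -
  have "matrix_inv (diag l) = diag (\<chi> i. 1 / l $ i)"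
    using l by (intro matrix_inv_diag) (metis less_irrefl)
  note st = step [unfolded perturbed_step_def Let_def this]
  show y: "subvec B y = y" and q: "subvec (- B) q = q" using st by auto
  have D: "(- (submat I I (diag (\<chi> i. 1 / l $ i)) ** submat I I (diag s)) + E) *v x
     = E *v x - (\<chi> i. (s $ i / l $ i) * x $ i)" if x: "subvec I x = x" for I E x
  proof -
    have "(submat I I (diag (\<chi> i. 1 / l $ i)) ** submat I I (diag s)) *v x
        = subvec I (\<chi> i. (s $ i / l $ i) * x $ i)"
      unfolding matrix_vector_mul_assoc [symmetric] submat_diag_mult_vec
      by (simp add: subvec_def vec_eq_iff)
    also have "\<dots> = (\<chi> i. (s $ i / l $ i) * subvec I x $ i)"
      by (simp add: subvec_def vec_eq_iff)
    finally show ?thesis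
      unfolding x by (simp add: matrix_vector_mult_diff_rdistrib)
  qed
  have rhs: "- subvec I (g z) + submat I I (diag (\<chi> i. 1 / l $ i)) *v subvec I t = subvec I rhs" for I
    unfolding submat_diag_mult_vec by (simp add: rhs_def subvec_def vec_eq_iff)
  from st show "lagr_zz \<phi> g z l *v w + submat UNIV B (gradmat g z) *v y + submat UNIV (- B) (gradmat g z) *v q
      = - lagr_z \<phi> g z l + f1 - (E11 *v w + E12 *v y + E13 *v q)"
    by (simp add: matrix_vector_mult_add_rdistrib algebra_simps)
  from st show "transpose (submat UNIV B (gradmat g z)) *v w - (\<chi> i. (s $ i / l $ i) * y $ i)
      = subvec B rhs + f2 - (E21 *v w + E22 *v y + E23 *v q)"
    unfolding D [OF y] rhs by (simp add: matrix_vector_mult_add_rdistrib algebra_simps)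
  from st show "transpose (submat UNIV (- B) (gradmat g z)) *v w - (\<chi> i. (s $ i / l $ i) * q $ i)
      = subvec (- B) rhs + f3 - (E31 *v w + E32 *v y + E33 *v q)"
    unfolding D [OF q] rhs by (simp add: matrix_vector_mult_add_rdistrib algebra_simps)
qed

section \<open>The error of the computed step\<close>

text \<open>W, Y, Q are the norms of the computed step, known only as exact size plus error a, b, c.
  After weighting the third row by m, the coefficients of W, Y, Q are at most u/m, u, u/m in every
  row, so the exact sizes m, 1, m contribute O(u) and the errors O(u/m) * \<rho>.\<close>

lemma perturbation_absorb:
  fixes m u \<eta> W Y Q a b c \<rho> R1 R2 R3 Ku Ks K1 :: real
  assumes m: "0 < m" "m \<le> 1" and u: "0 \<le> u" "u / m \<le> \<eta>" and pos: "0 < Ku" "0 < Ks" "0 \<le> K1"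
    and nonneg: "0 \<le> W" "0 \<le> Y" "0 \<le> Q" "0 \<le> a" "0 \<le> b" "0 \<le> c"
    and WYQ: "W \<le> K1 * m + a" "Y \<le> K1 + b" "Q \<le> K1 * m + c"
    and abc: "a \<le> Ks * \<rho>" "m * b \<le> Ks * \<rho>" "c \<le> Ks * \<rho>"
    and R1: "R1 \<le> Ku * u / m * W + Ku * u * Y + Ku * u / m * Q + Ku * u"
    and R2: "R2 \<le> Ku * u * W + Ku * u * Y + Ku * u / m * Q + Ku * u"
    and R3: "R3 \<le> Ku * u / m * W + Ku * u / m * Y + Ku * u / m\<^sup>2 * Q + Ku * u"
    and \<rho>: "\<rho> = R1 + R2 + m * R3" and \<eta>: "18 * Ku * Ks * \<eta> \<le> 1"
  shows "\<rho> \<le> 6 * Ku * (3 * K1 + 1) * u"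
proof -
  define n where "n = u / m"
  have n: "0 \<le> n" "n \<le> \<eta>" and un: "u = n * m"
    using m u by (simp_all add: n_def)
  have un': "u \<le> n" using mult_left_mono [OF m(2) n(1)] by (simp add: un)
  define T where "T = n * W + u * Y + n * Q + u"
  have uW: "u * W \<le> n * W" using un' nonneg by (simp add: mult_right_mono)
  have Km: "Ku * x \<le> Ku * y" if "x \<le> y" for x y using that pos by simp
  have "R1 \<le> Ku * T" using R1 by (simp add: T_def n_def algebra_simps)
  moreover have "R2 \<le> Ku * T"
    using R2 Km [OF uW] by (simp add: T_def n_def algebra_simps)
  moreover have "m * R3 \<le> Ku * T"
  proof -
    have "m * R3 \<le> m * (Ku * u / m * W + Ku * u / m * Y + Ku * u / m\<^sup>2 * Q + Ku * u)"
      using R3 m by (intro mult_left_mono) auto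
    also have "\<dots> = Ku * (u * W) + Ku * (u * Y) + Ku * (n * Q) + Ku * (m * u)"
      using m by (simp add: n_def field_simps power2_eq_square)
    also have "\<dots> \<le> Ku * (n * W) + Ku * (u * Y) + Ku * (n * Q) + Ku * u"
      using Km [OF uW] Km [of "m * u" u] m u by (simp add: mult_left_le_one_le)
    finally show ?thesis by (simp add: T_def algebra_simps)
  qed
  ultimately have \<rho>T: "\<rho> \<le> 3 * (Ku * T)" using \<rho> by linarith
  have \<eta>\<rho>: "n * x \<le> \<eta> * (Ks * \<rho>)" if "x \<le> Ks * \<rho>" "0 \<le> x" for x
    using that n by (intro mult_mono) auto
  have "n * W \<le> K1 * u + \<eta> * (Ks * \<rho>)"
    using mult_left_mono [OF WYQ(1) n(1)] \<eta>\<rho> [OF abc(1) nonneg(4)] by (simp add: un algebra_simps)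
  moreover have "u * Y \<le> K1 * u + \<eta> * (Ks * \<rho>)"
    using mult_left_mono [OF WYQ(2) u(1)] \<eta>\<rho> [OF abc(2)] m nonneg by (simp add: un algebra_simps)
  moreover have "n * Q \<le> K1 * u + \<eta> * (Ks * \<rho>)"
    using mult_left_mono [OF WYQ(3) n(1)] \<eta>\<rho> [OF abc(3) nonneg(6)] by (simp add: un algebra_simps)
  ultimately have "T \<le> (3 * K1 + 1) * u + 3 * (\<eta> * (Ks * \<rho>))"
    by (simp add: T_def algebra_simps)
  \<comment> \<open>9 = 3 * 3: three rows, and three unknowns each contributing \<eta> * Ks *
    \<rho>. The 18 in the condition on \<eta> makes this term at most \<rho> / 2, hence the 6 in the
    conclusion.\<close>
  from Km [OF this] \<rho>T
  have "\<rho> \<le> 3 * Ku * (3 * K1 + 1) * u + 9 * Ku * Ks * \<eta> * \<rho>"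
    by (simp add: algebra_simps)
  moreover have "0 \<le> \<rho>" using abc(1) nonneg(4) pos(2) by (smt (verit) zero_le_mult_iff)
  then have "18 * Ku * Ks * \<eta> * \<rho> \<le> \<rho>" using mult_right_mono [OF \<eta>, of \<rho>] by simp
  ultimately show ?thesis by simp
qed

lemma norm_sum3_diff_le:
  fixes p :: "'a::real_normed_vector"
  assumes "norm p \<le> P" "norm q \<le> Q" "norm r \<le> R" "norm f \<le> F"
  shows "norm (p + q + r - f) \<le> P + Q + R + F"
  using assms norm_triangle_ineq4 [of "p + q + r" f] norm_triangle_ineq [of "p + q" r]
    norm_triangle_ineq [of p q] by linarith

lemma step_error_bound:
  fixes \<phi> :: "real^'n \<Rightarrow> real" and g :: "real^'n \<Rightarrow> real^'m" and zs :: "real^'n"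
  defines "B \<equiv> active g zs"
  defines "A \<equiv> submat UNIV B (gradmat g zs)"
  assumes M: "1 \<le> M" and C: "0 < C" and Kt: "0 < Kt" and Ku: "0 < Ku"
    and ker: "\<And>x. \<exists>v. A *v v = 0 \<and> norm (x - v) \<le> M * norm (A *v x)"
    and kerT: "\<And>x. \<exists>v. transpose A *v v = 0 \<and> norm (x - v) \<le> M * norm (transpose A *v x)"
    and bounds: "step_bounds \<phi> g zs M z l s" and ok: "iterate_ok \<phi> g C \<gamma> z l s"
    and \<mu>_def: "\<mu> = mu l s" and \<mu>: "\<mu> \<le> 1" "Ks * \<mu> \<le> 1" and u: "0 \<le> u" "u / \<mu> \<le> \<eta>"
    and Ks: "Ks = 48 * (M^2)^4" and K1: "K1 = Ks * (C + 2 * (M + M * Kt))"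
    and \<eta>: "18 * Ku * Ks * \<eta> \<le> 1" and K2: "K2 = Ks * (6 * Ku * (3 * K1 + 1))"
    and t: "norm t \<le> Kt * \<mu>\<^sup>2"
    and E: "norm E11 \<le> Ku * u / \<mu>" "norm E33 \<le> Ku * u / \<mu>\<^sup>2"
      "norm E12 \<le> Ku * u" "norm E21 \<le> Ku * u" "norm E22 \<le> Ku * u"
      "norm E13 \<le> Ku * u / \<mu>" "norm E31 \<le> Ku * u / \<mu>"
      "norm E23 \<le> Ku * u / \<mu>" "norm E32 \<le> Ku * u / \<mu>"
      "norm f1 \<le> Ku * u" "norm f2 \<le> Ku * u" "norm f3 \<le> Ku * u"
    and pert: "perturbed_step \<phi> g B z l s t E11 E12 E13 E21 E22 E23 E31 E32 E33 f1 f2 f3 w y q"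
    and exact: "exact_step \<phi> g z l s t dz dl ds"
  shows "norm (dz - w) \<le> K2 * u" and "\<mu> * norm (subvec B dl - y) \<le> K2 * u"
    and "norm (subvec (- B) dl - q) \<le> K2 * u"
    and "\<exists>v. A *v v = 0 \<and> norm (subvec B dl - y - v) \<le> K2 * u"
proof -
  have l: "\<And>i. 0 < l $ i" and lagr: "norm (lagr_z \<phi> g z l) \<le> C * \<mu>"
    using ok by (auto simp: iterate_ok_def \<mu>_def)
  have m: "0 < \<mu>" using mu_pos [OF ok] by (simp add: \<mu>_def)
  note sb = bounds [unfolded step_bounds_def Let_def, folded B_def \<mu>_def, folded A_def]
  have Kspos: "0 < Ks" using M by (simp add: Ks)
  have M0: "0 < M" using M by simp
  define A' where "A' = submat UNIV B (gradmat g z)"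
  define G where "G = submat UNIV (- B) (gradmat g z)"
  define H where "H = lagr_zz \<phi> g z l"
  define D where "D = (\<chi> i. s $ i / l $ i)"
  define v where "v = (\<chi> i. - g z $ i + t $ i / l $ i)"
  \<comment> \<open>Applied twice: to the exact step, for its size, and to the difference of the
    steps, for the error.\<close>
  have saddle: "norm a \<le> Ks * \<rho> \<and> \<mu> * norm b \<le> Ks * \<rho> \<and> norm c \<le> Ks * \<rho> \<and>
      (\<exists>v. A *v v = 0 \<and> norm (b - v) \<le> Ks * \<rho>)"
    if "subvec B b = b" "subvec (- B) c = c" "H *v a + A' *v b + G *v c = r1"
      "transpose A' *v a - (\<chi> i. D $ i * b $ i) = r2" "transpose G *v a - (\<chi> i. D $ i * c $ i) = r3"
      "\<rho> = norm r1 + norm r2 + \<mu> * norm r3" for a b c r1 r2 r3 \<rho>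
  proof (rule saddle_estimate [OF M m _ ker kerT])
    show "48 * (M\<^sup>2) ^ 4 * \<mu> \<le> 1" using \<mu>(2) by (simp add: Ks)
    show "A *v subvec B x = A *v x" for x
      unfolding A_def submat_mult_vec by (simp add: subvec_def cong: if_cong)
    show "(norm w)\<^sup>2 \<le> M * (w \<bullet> (H *v w))" if "transpose A *v w = 0" for w
      using sb that unfolding H_def by blast
    show "norm (A' - A) \<le> M * \<mu>" "norm H \<le> M" using sb by (auto simp: A'_def H_def)
    show "norm G \<le> M" using sb norm_submat_le order_trans unfolding G_def by blast
    show "\<mu> \<le> M * D $ i \<and> D $ i \<le> M * \<mu>" if "i \<in> B" for i using sb that by (simp add: D_def)
    show "1 \<le> M * \<mu> * D $ i" if "i \<notin> B" for i using sb that by (simp add: D_def)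
  qed (use that Ks in auto)
  have idem: "subvec I (subvec I x) = subvec I x" for I and x :: "real^'m"
    by (simp add: subvec_def cong: if_cong)
  note exact_eqs = exact_step_saddle [OF exact l, folded v_def]
  have ex1: "H *v dz + A' *v subvec B dl + G *v subvec (- B) dl = - lagr_z \<phi> g z l"
    using exact_eqs(1) [of B] by (simp add: H_def A'_def G_def)
  have ex2: "transpose A' *v dz - (\<chi> i. D $ i * subvec B dl $ i) = subvec B v"
    using exact_eqs(2) [of B] by (simp add: A'_def D_def)
  have ex3: "transpose G *v dz - (\<chi> i. D $ i * subvec (- B) dl $ i) = subvec (- B) v"
    using exact_eqs(2) [of "- B"] by (simp add: G_def D_def)
  define \<rho>e where "\<rho>e = norm (- lagr_z \<phi> g z l) + norm (subvec B v) + \<mu> * norm (subvec (- B) v)"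
  note exact_bound = saddle [OF idem idem ex1 ex2 ex3 \<rho>e_def]
  have v_split: "subvec I v = subvec I (\<chi> i. t $ i / l $ i) - subvec I (g z)" for I
    by (simp add: v_def subvec_def vec_eq_iff)
  have m2: "\<mu>\<^sup>2 \<le> \<mu>" using m \<mu>(1) by (simp add: power2_eq_square mult_left_le)
  have t': "norm t \<le> Kt * \<mu>" using t mult_left_mono [OF m2, of Kt] Kt by linarith
  have tB: "norm (subvec B (\<chi> i. t $ i / l $ i)) \<le> M * norm t"
  proof (rule norm_vec_le_scaled)
    fix i
    show "\<bar>subvec B (\<chi> i. t $ i / l $ i) $ i\<bar> \<le> M * \<bar>t $ i\<bar>"
    proof (cases "i \<in> B")
      case True
      then have "1 / l $ i \<le> M" using sb by blast
      from mult_right_mono [OF this, of "\<bar>t $ i\<bar>"] show ?thesis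
        using l [of i] True by (simp add: subvec_def)
    qed (use M0 in \<open>simp add: subvec_def\<close>)
  qed (use M0 in simp)
  \<comment> \<open>Off \<open>B\<close> the quotient 1 / l_i may be of order 1/\<mu>; the weight
    \<mu> of the third row compensates.\<close>
  have tN: "norm (subvec (- B) (\<chi> i. t $ i / l $ i)) \<le> M / \<mu> * norm t"
  proof (rule norm_vec_le_scaled)
    fix i
    show "\<bar>subvec (- B) (\<chi> i. t $ i / l $ i) $ i\<bar> \<le> M / \<mu> * \<bar>t $ i\<bar>"
    proof (cases "i \<in> - B")
      case True
      then have "\<mu> * (1 / l $ i) \<le> M" using sb by blast
      then have "1 / l $ i \<le> M / \<mu>" using m l [of i] by (simp add: field_simps)
      from mult_right_mono [OF this, of "\<bar>t $ i\<bar>"] show ?thesis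
        using l [of i] True by (simp add: subvec_def)
    qed (use M0 m in \<open>simp add: subvec_def\<close>)
  qed (use M0 m in simp)
  have "norm (subvec B v) \<le> (M + M * Kt) * \<mu>"
  proof -
    have "norm (subvec B v) \<le> M * norm t + M * \<mu>"
      unfolding v_split using norm_triangle_ineq4 [of "subvec B (\<chi> i. t $ i / l $ i)" "subvec B (g z)"] tB sb
      by linarith
    also have "\<dots> \<le> M * (Kt * \<mu>) + M * \<mu>" using t' M0 by simp
    finally show ?thesis by (simp add: algebra_simps)
  qed
  moreover have "\<mu> * norm (subvec (- B) v) \<le> (M + M * Kt) * \<mu>"
  proof -
    have "norm (subvec (- B) (g z)) \<le> M" using norm_subvec_le [of "- B" "g z"] sb by linarith
    then have "norm (subvec (- B) v) \<le> M / \<mu> * norm t + M"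
      unfolding v_split
      using norm_triangle_ineq4 [of "subvec (- B) (\<chi> i. t $ i / l $ i)" "subvec (- B) (g z)"] tN by linarith
    then have "\<mu> * norm (subvec (- B) v) \<le> \<mu> * (M / \<mu> * norm t + M)"
      using m by (intro mult_left_mono) auto
    also have "\<dots> = M * norm t + M * \<mu>" using m by (simp add: algebra_simps)
    also have "\<dots> \<le> M * (Kt * \<mu>) + M * \<mu>" using t' M0 by simp
    finally show ?thesis by (simp add: algebra_simps)
  qed
  \<comment> \<open>C comes from the dual residual, and each of the two constraint blocks adds M + M
    * Kt.\<close>
  ultimately have "\<rho>e \<le> (C + 2 * (M + M * Kt)) * \<mu>"
    unfolding \<rho>e_def using lagr by (simp add: algebra_simps)
  then have "Ks * \<rho>e \<le> Ks * ((C + 2 * (M + M * Kt)) * \<mu>)" using Kspos by simp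
  then have Kse: "Ks * \<rho>e \<le> K1 * \<mu>" by (simp add: K1 mult.assoc)
  have exact_dz: "norm dz \<le> K1 * \<mu>" and exact_N: "norm (subvec (- B) dl) \<le> K1 * \<mu>"
    and "\<mu> * norm (subvec B dl) \<le> K1 * \<mu>"
    using exact_bound Kse by linarith+
  then have exact_B: "norm (subvec B dl) \<le> K1" using m by (simp add: mult.commute)
  note pert_eqs = perturbed_step_saddle [OF pert l, folded v_def]
  define a where "a = dz - w"
  define b where "b = subvec B dl - y"
  define c where "c = subvec (- B) dl - q"
  define r1 where "r1 = E11 *v w + E12 *v y + E13 *v q - f1"
  define r2 where "r2 = E21 *v w + E22 *v y + E23 *v q - f2"
  define r3 where "r3 = E31 *v w + E32 *v y + E33 *v q - f3"
  define \<rho> where "\<rho> = norm r1 + norm r2 + \<mu> * norm r3"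
  have bound: "norm a \<le> Ks * \<rho> \<and> \<mu> * norm b \<le> Ks * \<rho> \<and> norm c \<le> Ks * \<rho> \<and>
      (\<exists>v. A *v v = 0 \<and> norm (b - v) \<le> Ks * \<rho>)"
  proof (rule saddle [OF _ _ _ _ _ \<rho>_def])
    show "subvec B b = b" "subvec (- B) c = c"
      using pert_eqs(4,5) by (simp_all add: b_def c_def subvec_diff idem)
    have "H *v a + A' *v b + G *v c = (H *v dz + A' *v subvec B dl + G *v subvec (- B) dl)
        - (H *v w + A' *v y + G *v q)"
      by (simp add: a_def b_def c_def matrix_vector_mult_diff_distrib)
    also have "\<dots> = r1"
      unfolding ex1 using pert_eqs(1) by (simp add: H_def A'_def G_def r1_def)
    finally show "H *v a + A' *v b + G *v c = r1" .
    have "transpose A' *v a - (\<chi> i. D $ i * b $ i) = (transpose A' *v dz - (\<chi> i. D $ i * subvec B dl $ i))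
        - (transpose A' *v w - (\<chi> i. D $ i * y $ i))"
      by (simp add: a_def b_def matrix_vector_mult_diff_distrib vec_eq_iff right_diff_distrib)
    also have "\<dots> = r2"
      unfolding ex2 using pert_eqs(2) by (simp add: D_def A'_def r2_def)
    finally show "transpose A' *v a - (\<chi> i. D $ i * b $ i) = r2" .
    have "transpose G *v a - (\<chi> i. D $ i * c $ i) = (transpose G *v dz - (\<chi> i. D $ i * subvec (- B) dl $ i))
        - (transpose G *v w - (\<chi> i. D $ i * q $ i))"
      by (simp add: a_def c_def matrix_vector_mult_diff_distrib vec_eq_iff right_diff_distrib)
    also have "\<dots> = r3"
      unfolding ex3 using pert_eqs(3) by (simp add: D_def G_def r3_def)
    finally show "transpose G *v a - (\<chi> i. D $ i * c $ i) = r3" .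
  qed
  have "\<rho> \<le> 6 * Ku * (3 * K1 + 1) * u"
  proof (rule perturbation_absorb [OF m \<mu>(1) u Ku Kspos])
    show "0 \<le> K1" using Kspos C M0 Kt by (simp add: K1)
    show "norm w \<le> K1 * \<mu> + norm a"
      using exact_dz norm_triangle_ineq4 [of dz a] by (simp add: a_def)
    show "norm y \<le> K1 + norm b"
      using exact_B norm_triangle_ineq4 [of "subvec B dl" b] by (simp add: b_def)
    show "norm q \<le> K1 * \<mu> + norm c"
      using exact_N norm_triangle_ineq4 [of "subvec (- B) dl" c] by (simp add: c_def)
    show "norm a \<le> Ks * \<rho>" "\<mu> * norm b \<le> Ks * \<rho>" "norm c \<le> Ks * \<rho>" using bound by auto
    show "norm r1 \<le> Ku * u / \<mu> * norm w + Ku * u * norm y + Ku * u / \<mu> * norm q + Ku * u"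
      unfolding r1_def by (intro norm_sum3_diff_le norm_matrix_vector_mono E)
    show "norm r2 \<le> Ku * u * norm w + Ku * u * norm y + Ku * u / \<mu> * norm q + Ku * u"
      unfolding r2_def by (intro norm_sum3_diff_le norm_matrix_vector_mono E)
    show "norm r3 \<le> Ku * u / \<mu> * norm w + Ku * u / \<mu> * norm y + Ku * u / \<mu>\<^sup>2 * norm q + Ku * u"
      unfolding r3_def by (intro norm_sum3_diff_le norm_matrix_vector_mono E)
  qed (use \<rho>_def \<eta> in auto)
  then have "Ks * \<rho> \<le> Ks * (6 * Ku * (3 * K1 + 1) * u)" using Kspos by simp
  then have "Ks * \<rho> \<le> K2 * u" by (simp add: K2 mult.assoc)
  with bound show "norm (dz - w) \<le> K2 * u" "\<mu> * norm (subvec B dl - y) \<le> K2 * u"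
    "norm (subvec (- B) dl - q) \<le> K2 * u" "\<exists>v. A *v v = 0 \<and> norm (subvec B dl - y - v) \<le> K2 * u"
    unfolding a_def b_def c_def by (auto intro: order_trans)
qed

theorem corollary4p4:
  fixes \<phi> :: "real^'n \<Rightarrow> real" and g :: "real^'n \<Rightarrow> real^'m" and zs :: "real^'n"
    and C \<gamma> Kt Ku :: real
  assumes "twice_lipschitz_diff \<phi>" and "\<forall>i. twice_lipschitz_diff (\<lambda>z. g z $ i)"
    and "nlp_solution \<phi> g zs" and "multipliers \<phi> g zs \<noteq> {}"
    and "mfcq g zs" and "second_order_cond \<phi> g zs" and "strict_complementarity \<phi> g zs"
    and "0 < C" and "0 < \<gamma>" and "\<gamma> < 1" and "0 < Kt" and "0 < Ku"
  shows "\<exists>\<epsilon>>0. \<exists>\<eta>>0. \<exists>\<beta>0>0. \<exists>K'>0.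
    \<forall>(z :: real^'n) (lam :: real^'m) (s :: real^'m) (t :: real^'m) (u :: real) (\<beta> :: real)
      r Uh Vh sg U V
      E11 E12 E13 E21 E22 E23 E31 E32 E33 f1 f2 f3 w y q dz dlam ds.
      let B = active g zs; N = - B; \<mu> = mu lam s in
      iterate_ok \<phi> g C \<gamma> z lam s \<and>
      norm t \<le> Kt * \<mu>\<^sup>2 \<and>
      infdist (z, lam) ({zs} \<times> multipliers \<phi> g zs) \<le> \<epsilon> \<and>
      \<mu> \<le> \<epsilon> \<and> 0 \<le> u \<and> u / \<mu> \<le> \<eta> \<and> u \<le> \<eta> \<and> \<beta>0 \<le> \<beta> \<and>
      svd B (submat UNIV B (gradmat g zs)) r Uh Vh sg U V \<and>
      ereal (\<beta> * max (\<mu> powr (1/3)) (u / \<mu>)) \<le> sigma_min (diag_sg r sg) \<and>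
      (\<forall>lams\<in>multipliers \<phi> g zs. ereal (\<beta> * max (\<mu> powr (1/3)) (u / \<mu>))
         \<le> sigma_min (compress (CARD('n) - r) Vh (lagr_zz \<phi> g zs lams))) \<and>
      norm E11 \<le> Ku * u / \<mu> \<and> norm E33 \<le> Ku * u / \<mu>\<^sup>2 \<and>
      norm E12 \<le> Ku * u \<and> norm E21 \<le> Ku * u \<and> norm E22 \<le> Ku * u \<and>
      norm E13 \<le> Ku * u / \<mu> \<and> norm E31 \<le> Ku * u / \<mu> \<and>
      norm E23 \<le> Ku * u / \<mu> \<and> norm E32 \<le> Ku * u / \<mu> \<and>
      norm f1 \<le> Ku * u \<and> norm f2 \<le> Ku * u \<and> norm f3 \<le> Ku * u \<and>
      perturbed_step \<phi> g B z lam s t E11 E12 E13 E21 E22 E23 E31 E32 E33 f1 f2 f3 w y q \<and>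
      exact_step \<phi> g z lam s t dz dlam ds
      \<longrightarrow>
      norm (dz - w, norm_tmult r U (subvec B dlam - y)) \<le> K' * u \<and>
      norm_tmult (card B - r) V (subvec B dlam - y) \<le> K' * u / \<mu> \<and>
      norm (subvec N dlam - q) \<le> K' * u"
proof -
  let ?B = "active g zs" and ?A = "submat UNIV (active g zs) (gradmat g zs)"
  obtain \<kappa>1 where \<kappa>1: "0 < \<kappa>1" "\<And>x. \<exists>v. ?A *v v = 0 \<and> norm (x - v) \<le> \<kappa>1 * norm (?A *v x)"
    using matrix_dist_kernel_le [of ?A] by blast
  obtain \<kappa>2 where \<kappa>2: "0 < \<kappa>2"
      "\<And>x. \<exists>v. transpose ?A *v v = 0 \<and> norm (x - v) \<le> \<kappa>2 * norm (transpose ?A *v x)"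
    using matrix_dist_kernel_le [of "transpose ?A"] by blast
  obtain M where M: "1 \<le> M" "max \<kappa>1 \<kappa>2 \<le> M"
      "\<forall>\<^sub>F (z, l, s) in iterates \<phi> g C \<gamma> zs. step_bounds \<phi> g zs M z l s"
    using eventually_step_bounds [OF assms(1,2,4,5,6,7,8,9), of "max \<kappa>1 \<kappa>2"] by blast
  have ker: "\<exists>v. ?A *v v = 0 \<and> norm (x - v) \<le> M * norm (?A *v x)" for x
    using \<kappa>1(2) [of x] M(2) mult_right_mono [of \<kappa>1 M "norm (?A *v x)"] by fastforce
  have kerT: "\<exists>v. transpose ?A *v v = 0 \<and> norm (x - v) \<le> M * norm (transpose ?A *v x)" for x
    using \<kappa>2(2) [of x] M(2) mult_right_mono [of \<kappa>2 M "norm (transpose ?A *v x)"] by fastforce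
  obtain \<epsilon>0 where \<epsilon>0: "0 < \<epsilon>0" "\<And>z l s. iterate_ok \<phi> g C \<gamma> z l s \<Longrightarrow>
      infdist (z, l) ({zs} \<times> multipliers \<phi> g zs) \<le> \<epsilon>0 \<Longrightarrow> mu l s \<le> \<epsilon>0 \<Longrightarrow> step_bounds \<phi> g zs M z l s"
    using M(3) unfolding eventually_iterates by blast
  define Ks where "Ks = 48 * (M^2)^4"
  define K1 where "K1 = Ks * (C + 2 * (M + M * Kt))"
  define K2 where "K2 = Ks * (6 * Ku * (3 * K1 + 1))"
  define \<eta> where "\<eta> = 1 / (18 * Ku * Ks)"
  \<comment> \<open>\<epsilon>0 provides \<open>step_bounds\<close>; 1 and 1 / Ks provide \<mu>
    \<le> 1 and the absorption condition of \<open>saddle_estimate\<close>.\<close>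
  define \<epsilon> where "\<epsilon> = min \<epsilon>0 (min 1 (1 / Ks))"
  have Ks: "0 < Ks" using M(1) by (simp add: Ks_def)
  have K1: "0 < K1" using Ks \<open>0 < C\<close> \<open>0 < Kt\<close> M(1) by (simp add: K1_def add_pos_pos)
  have K2: "0 < K2" using Ks K1 \<open>0 < Ku\<close> by (simp add: K2_def add_pos_pos)
  have \<eta>: "0 < \<eta>" "18 * Ku * Ks * \<eta> \<le> 1" using Ks \<open>0 < Ku\<close> by (simp_all add: \<eta>_def)
  have \<epsilon>: "0 < \<epsilon>" using \<epsilon>0(1) Ks by (simp add: \<epsilon>_def)
  \<comment> \<open>The 2 accounts for the pair of dz - w and the U-part, whose norm is at most the
    sum of two norms.\<close>
  have K': "0 < 2 * K2" using K2 by simp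
  show ?thesis
  proof (rule exI [of _ \<epsilon>], rule conjI [OF \<epsilon>], rule exI [of _ \<eta>], rule conjI [OF \<eta>(1)],
      rule exI [of _ 1], rule conjI [OF less_numeral_extra(1)], rule exI [of _ "2 * K2"], rule conjI [OF K'],
      unfold Let_def, intro allI impI, elim conjE)
    fix z :: "real^'n" and lam s t :: "real^'m" and u :: real
      and r Uh Vh sg U V and E11 :: "real^'n^'n" and E12 E13 :: "real^'m^'n"
      and E21 E31 :: "real^'n^'m" and E22 E23 E32 E33 :: "real^'m^'m"
      and f1 w dz :: "real^'n" and f2 f3 y q dlam ds :: "real^'m"
    assume ok: "iterate_ok \<phi> g C \<gamma> z lam s"
      and near: "infdist (z, lam) ({zs} \<times> multipliers \<phi> g zs) \<le> \<epsilon>" "mu lam s \<le> \<epsilon>"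
      and svd: "svd ?B ?A r Uh Vh sg U V"
      and u: "0 \<le> u" "u / mu lam s \<le> \<eta>"
      and bounds: "norm t \<le> Kt * (mu lam s)\<^sup>2"
        "norm E11 \<le> Ku * u / mu lam s" "norm E33 \<le> Ku * u / (mu lam s)\<^sup>2"
        "norm E12 \<le> Ku * u" "norm E21 \<le> Ku * u" "norm E22 \<le> Ku * u"
        "norm E13 \<le> Ku * u / mu lam s" "norm E31 \<le> Ku * u / mu lam s"
        "norm E23 \<le> Ku * u / mu lam s" "norm E32 \<le> Ku * u / mu lam s"
        "norm f1 \<le> Ku * u" "norm f2 \<le> Ku * u" "norm f3 \<le> Ku * u"
      and pert: "perturbed_step \<phi> g ?B z lam s t E11 E12 E13 E21 E22 E23 E31 E32 E33 f1 f2 f3 w y q"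
      and exact: "exact_step \<phi> g z lam s t dz dlam ds"
    have m: "0 < mu lam s" using mu_pos [OF ok] .
    have small: "mu lam s \<le> 1" "Ks * mu lam s \<le> 1"
      using near(2) Ks by (auto simp: \<epsilon>_def field_simps)
    have "step_bounds \<phi> g zs M z lam s"
      using near by (intro \<epsilon>0(2) ok) (auto simp: \<epsilon>_def)
    note err = step_error_bound [OF M(1) \<open>0 < C\<close> \<open>0 < Kt\<close> \<open>0 < Ku\<close> ker kerT this ok refl small u
        Ks_def K1_def \<eta>(2) K2_def bounds pert exact]
    obtain v where v: "?A *v v = 0" "norm (subvec ?B dlam - y - v) \<le> K2 * u"
      using err(4) by blast
    have K2u: "0 \<le> K2 * u" using K2 u(1) by simp
    show "norm (dz - w, norm_tmult r U (subvec ?B dlam - y)) \<le> 2 * K2 * u \<and>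
        norm_tmult (card ?B - r) V (subvec ?B dlam - y) \<le> 2 * K2 * u / mu lam s \<and>
        norm (subvec (- ?B) dlam - q) \<le> 2 * K2 * u"
    proof (intro conjI)
      \<comment> \<open>The U-part sees only the distance of the error to ker A and so avoids the
        factor 1/\<mu>, whereas the V-part below is bounded by the full norm.\<close>
      have tm: "norm_tmult r U (subvec ?B dlam - y) \<le> K2 * u"
        using norm_tmult_range_le [OF svd v(1)] v(2) by (rule order_trans)
      have "0 \<le> norm_tmult r U (subvec ?B dlam - y)" by (simp add: norm_tmult_def L2_set_nonneg)
      then have "norm (dz - w, norm_tmult r U (subvec ?B dlam - y))
          \<le> norm (dz - w) + norm_tmult r U (subvec ?B dlam - y)"
        using norm_Pair_le [of "dz - w" "norm_tmult r U (subvec ?B dlam - y)"] by simp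
      then show "norm (dz - w, norm_tmult r U (subvec ?B dlam - y)) \<le> 2 * K2 * u"
        using err(1) tm by linarith
      have "norm_tmult (card ?B - r) V (subvec ?B dlam - y) \<le> norm (subvec ?B dlam - y)"
        by (rule norm_tmult_le [OF svd_orthonormal_cols(3) [OF svd]])
      also have "\<dots> \<le> K2 * u / mu lam s"
        using err(2) m by (simp add: field_simps)
      also have "\<dots> \<le> 2 * K2 * u / mu lam s"
        using K2u m by (intro divide_right_mono) auto
      finally show "norm_tmult (card ?B - r) V (subvec ?B dlam - y) \<le> 2 * K2 * u / mu lam s" .
      show "norm (subvec (- ?B) dlam - q) \<le> 2 * K2 * u" using err(3) K2u by linarith
    qed
  qed
qed

end
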